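(* Suppose that $f+\Phi$ is bounded from below and that the parameters satisfy $$2\gamma L(|1-a|+\gamma L)+|1-a|+\gamma L+b\gamma L<1,\qquad ab+\tfrac{a}{2}+\tfrac12 a|1-a|+\tfrac12\gamma aL+\tfrac12\gamma abL<b.$$ For $x_0,y_0\in\mathbb{R}^n$, let $(x,y)\in C^1([0,+\infty),\mathbb{R}^n)\times C^2([0,+\infty),\mathbb{R}^n)$ be the unique global solution of the dynamical system $$\dot x(t)+x(t)=\operatorname{prox}_{\gamma f}\big[x(t)-\gamma\nabla\Phi(x(t))-ax(t)-by(t)\big],\quad \dot y(t)+ax(t)+by(t)=0,\quad x(0)=x_0,\ y(0)=y_0.$$ Consider the function $$H:\mathbb{R}^n\times\mathbb{R}^n\times\mathbb{R}^n\to\mathbb{R}\cup\{+\infty\},\quad H(u,v,w)=(f+\Phi)(u)+\frac{1}{2\gamma}\|u-v\|^2+\frac{1}{2\gamma a}\|av+bw\|^2.$$ Suppose that $x$ is bounded and that $H$ satisfies the KL property at every point of $\operatorname{dom}\partial H$ with a function $\varphi$ of the form $\varphi(s)=Cs^{1-\theta}$, where $C>0$ and $\theta\in(0,1)$ (which may depend on the point). Then there exists $\overline{x}\in\operatorname{crit}(f+\Phi)$ such that $\lim_{t\to+\infty}x(t)=\overline{x}$ and $\lim_{t\to+\infty}y(t)=-\frac{a}{b}\overline{x}$. Let $\theta\in(0,1)$ be the Łojasiewicz exponent of $H$ at $\left(\overline{x},\overline{x},-\frac{a}{b}\overline{x}\right)\in\operatorname{crit}H$, that is, for some $C,\varepsilon>0$,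 $$\left|H(z)-H\left(\overline{x},\overline{x},-\tfrac{a}{b}\overline{x}\right)\right|^{\theta}\le C\|z^*\|\quad\text{for every } z \text{ with } \left\|z-\left(\overline{x},\overline{x},-\tfrac{a}{b}\overline{x}\right)\right\|<\varepsilon \text{ and every } z^*\in\partial H(z).$$ Then there exist $a_1,b_1,a_2,b_2>0$ and $t_0\ge 0$ such that for every $t\ge t_0$ the following statements are true: (a) if $\theta\in(0,\frac12)$, then $x$ and $y$ converge in finite time (i.e. they are constant on some interval $[T,+\infty)$); (b) if $\theta=\frac12$, then $\|x(t)-\overline{x}\|+\|y(t)+\frac{a}{b}\overline{x}\|\le a_1\exp(-b_1t)$; (c) if $\theta\in(\frac12,1)$, then $\|x(t)-\overline{x}\|+\|y(t)+\frac{a}{b}\overline{x}\|\le (a_2t+b_2)^{-\left(\frac{1-\theta}{2\theta-1}\right)}$.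
   Context: Standing setting: $\mathbb{R}^n$ carries the Euclidean inner product and norm; $a,b,\gamma>0$ are real numbers; $f:\mathbb{R}^n\to\mathbb{R}\cup\{+\infty\}$ is proper, convex and lower semicontinuous; $\Phi:\mathbb{R}^n\to\mathbb{R}$ is (possibly nonconvex) Fréchet differentiable with $L$-Lipschitz continuous gradient, $L>0$, i.e. $\|\nabla\Phi(x)-\nabla\Phi(y)\|\le L\|x-y\|$ for all $x,y\in\mathbb{R}^n$. The proximal operator is $\operatorname{prox}_{\gamma f}(y)=\operatorname{argmin}_{u\in\mathbb{R}^n}\{f(u)+\frac{1}{2\gamma}\|u-y\|^2\}$. For every $x_0,y_0$ the system has a unique global solution in $C^1\times C^2$. Subdifferentials: for a proper lower semicontinuous $g:\mathbb{R}^m\to\mathbb{R}\cup\{+\infty\}$ with $\operatorname{dom} g=\{x: g(x)<+\infty\}$, the Fréchet subdifferential at $x\in\operatorname{dom} g$ is $\hat\partial g(x)=\{v:\liminf_{y\to x}\frac{g(y)-g(x)-\langle v,y-x\rangle}{\|y-x\|}\ge 0\}$, and $\hat\partial g(x)=\emptyset$ for $x\notin\operatorname{dom} g$. The limiting subdifferential at $x\in\operatorname{dom} g$ is $\partial g(x)=\{v:\exists x_k\to x,\ g(x_k)\to g(x),\ \exists v_k\in\hat\partial g(x_k),\ v_k\to v\}$, and $\partial g(x)=\emptyset$ for $x\notin\operatorname{dom} g$. $\operatorname{crit}(g)=\{x:0\in\partial g(x)\}$. KL property: for $\eta\in(0,+\infty]$, $\Theta_\eta$ is the class of concave continuous functions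 $\varphi:[0,\eta)\to[0,+\infty)$ with $\varphi(0)=0$, $\varphi$ continuously differentiable on $(0,\eta)$ and $\varphi'(s)>0$ for all $s\in(0,\eta)$. A proper lower semicontinuous $g$ satisfies the Kurdyka-Łojasiewicz (KL) property at $\overline{x}\in\operatorname{dom}\partial g=\{x:\partial g(x)\ne\emptyset\}$, with the function $\varphi$, if there exist $\eta\in(0,+\infty]$ and a neighborhood $U$ of $\overline{x}$ such that $\varphi\in\Theta_\eta$ and $\varphi'(g(x)-g(\overline{x}))\operatorname{dist}(0,\partial g(x))\ge 1$ for all $x\in U$ with $g(\overline{x})<g(x)<g(\overline{x})+\eta$, where $\operatorname{dist}(x,A)=\inf_{y\in A}\|x-y\|$. *)

theory Defs
  imports "HOL-Analysis.Analysis"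
begin

text \<open>Functions with values in \<open>\<real> \<union> {+\<infinity>}\<close> are rendered as functions into \<^typ>\<open>ereal\<close>; the value
  \<open>-\<infinity>\<close> is excluded by \<open>proper_fun\<close>. Subtraction in \<^typ>\<open>ereal\<close> is only relied upon
  when the subtrahend is finite.\<close>

definition proper_fun :: "('a \<Rightarrow> ereal) \<Rightarrow> bool" where
  "proper_fun g \<longleftrightarrow> (\<forall>x. g x \<noteq> -\<infinity>) \<and> (\<exists>x. g x < \<infinity>)"

definition convex_fun :: "('a::real_vector \<Rightarrow> ereal) \<Rightarrow> bool" where
  "convex_fun g \<longleftrightarrow>
     (\<forall>x y. \<forall>t\<in>{0..1}. g ((1 - t) *\<^sub>R x + t *\<^sub>R y) \<le> ereal (1 - t) * g x + ereal t * g y)"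

definition lsc_fun :: "('a::topological_space \<Rightarrow> ereal) \<Rightarrow> bool" where
  "lsc_fun g \<longleftrightarrow> (\<forall>x. g x \<le> Liminf (at x) g)"

text \<open>For a proper, convex, lower semicontinuous function and \<open>\<gamma> > 0\<close> the minimizer exists and is
  unique, so that the choice in \<^const>\<open>arg_min\<close> is immaterial.\<close>

definition prox :: "real \<Rightarrow> ('a::real_normed_vector \<Rightarrow> ereal) \<Rightarrow> 'a \<Rightarrow> 'a" where
  "prox \<gamma> f y = arg_min (\<lambda>u. f u + ereal (1 / (2 * \<gamma>) * (norm (u - y))\<^sup>2)) (\<lambda>_. True)"

definition frechet_subdiff :: "('a::real_inner \<Rightarrow> ereal) \<Rightarrow> 'a \<Rightarrow> 'a set" where
  "frechet_subdiff g x =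
     {v. g x < \<infinity> \<and>
         Liminf (at x) (\<lambda>y. (g y - g x - ereal (v \<bullet> (y - x))) / ereal (norm (y - x))) \<ge> 0}"

definition limiting_subdiff :: "('a::real_inner \<Rightarrow> ereal) \<Rightarrow> 'a \<Rightarrow> 'a set" where
  "limiting_subdiff g x =
     {v. g x < \<infinity> \<and>
         (\<exists>X V. X \<longlonglongrightarrow> x \<and> (\<lambda>k. g (X k)) \<longlonglongrightarrow> g x \<and>
                (\<forall>k. V k \<in> frechet_subdiff g (X k)) \<and> V \<longlonglongrightarrow> v)}"

definition dom_subdiff :: "('a::real_inner \<Rightarrow> ereal) \<Rightarrow> 'a set" where
  "dom_subdiff g = {x. limiting_subdiff g x \<noteq> {}}"

definition crit :: "('a::real_inner \<Rightarrow> ereal) \<Rightarrow> 'a set" where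
  "crit g = {x. 0 \<in> limiting_subdiff g x}"

text \<open>Unlike \<^const>\<open>infdist\<close>, the distance to the empty set is \<open>\<infinity>\<close> here.\<close>

definition dist_to_set :: "'a::metric_space \<Rightarrow> 'a set \<Rightarrow> ereal" where
  "dist_to_set x A = (INF y\<in>A. ereal (dist x y))"

text \<open>Only the values of \<open>\<phi>\<close> on \<open>[0, \<eta>)\<close> matter.\<close>

definition desingularizing :: "ereal \<Rightarrow> (real \<Rightarrow> real) \<Rightarrow> bool" where
  "desingularizing \<eta> \<phi> \<longleftrightarrow>
     concave_on {s. 0 \<le> s \<and> ereal s < \<eta>} \<phi> \<and>
     continuous_on {s. 0 \<le> s \<and> ereal s < \<eta>} \<phi> \<and>
     (\<forall>s. 0 \<le> s \<and> ereal s < \<eta> \<longrightarrow> 0 \<le> \<phi> s) \<and>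
     \<phi> 0 = 0 \<and>
     (\<forall>s. 0 < s \<and> ereal s < \<eta> \<longrightarrow> \<phi> differentiable (at s) \<and> deriv \<phi> s > 0) \<and>
     continuous_on {s. 0 < s \<and> ereal s < \<eta>} (deriv \<phi>)"

definition KL_property_at :: "('a::real_inner \<Rightarrow> ereal) \<Rightarrow> 'a \<Rightarrow> (real \<Rightarrow> real) \<Rightarrow> bool" where
  "KL_property_at g xbar \<phi> \<longleftrightarrow>
     (\<exists>\<eta> U. 0 < \<eta> \<and> open U \<and> xbar \<in> U \<and> desingularizing \<eta> \<phi> \<and>
        (\<forall>x\<in>U. g xbar < g x \<and> g x < g xbar + \<eta> \<longrightarrow>
           ereal (deriv \<phi> (real_of_ereal (g x - g xbar))) * dist_to_set 0 (limiting_subdiff g x) \<ge> 1))"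

text \<open>A nonempty subdifferential forces \<open>g z\<close> to be finite, so that the conversion to
  \<^typ>\<open>real\<close> loses nothing when \<open>g zbar\<close> is finite.\<close>

definition Lojasiewicz_exponent_at :: "('a::real_inner \<Rightarrow> ereal) \<Rightarrow> 'a \<Rightarrow> real \<Rightarrow> bool" where
  "Lojasiewicz_exponent_at g zbar \<theta> \<longleftrightarrow>
     (\<exists>C>0. \<exists>\<epsilon>>0. \<forall>z. norm (z - zbar) < \<epsilon> \<longrightarrow>
        (\<forall>zs\<in>limiting_subdiff g z. \<bar>real_of_ereal (g z - g zbar)\<bar> powr \<theta> \<le> C * norm zs))"

text \<open>\<open>g\<close> is \<open>C\<^sup>1\<close> on \<open>[0, \<infinity>)\<close> (one-sidedly at \<open>0\<close>) with derivative \<open>g'\<close>.\<close>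

definition C1_halfline :: "(real \<Rightarrow> 'a::real_normed_vector) \<Rightarrow> (real \<Rightarrow> 'a) \<Rightarrow> bool" where
  "C1_halfline g g' \<longleftrightarrow>
     (\<forall>t\<ge>0. (g has_vector_derivative g' t) (at t within {0..})) \<and> continuous_on {0..} g'"

definition H_fun ::
  "real \<Rightarrow> real \<Rightarrow> real \<Rightarrow> ('a::real_inner \<Rightarrow> ereal) \<Rightarrow> ('a \<Rightarrow> real) \<Rightarrow> 'a \<times> 'a \<times> 'a \<Rightarrow> ereal" where
  "H_fun a b \<gamma> f \<Phi> = (\<lambda>(u, v, w).
     (f u + ereal (\<Phi> u)) + ereal (1 / (2 * \<gamma>) * (norm (u - v))\<^sup>2)
       + ereal (1 / (2 * \<gamma> * a) * (norm (a *\<^sub>R v + b *\<^sub>R w))\<^sup>2))"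

end

theory Submission
  imports Defs
begin

text \<open>
  The theorem is an instance of the Lojasiewicz argument for gradient-like curves. Write \<open>p = x + x'\<close> for the
  proximal point. The optimality condition of the proximal step provides a subgradient of the convex function \<open>f\<close> at
  \<open>p\<close>, namely \<open>\<xi> = (y' - x') / \<gamma> - G x\<close>, where \<open>G\<close> is the gradient of \<open>\<Phi>\<close>
  (\<open>prox_subgradient\<close>). With \<open>E = H (p, x, y)\<close> as energy, and \<open>X = (x, y)\<close>, two facts hold.

  The energy is dissipated: \<open>E' \<le> - c * (norm X')\<^sup>2\<close> with \<open>c > 0\<close>, by the conditions on the parameters
  (\<open>energy_dini\<close>). And the velocity controls a subgradient: some element of the limiting subdifferential of \<open>H\<close> at
  \<open>(p, x, y)\<close> has norm at most \<open>K * norm X'\<close> (\<open>H_subgradient_along\<close>).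

  Since the trajectory is bounded, \<open>X'\<close> is Lipschitz continuous, so an energy that is bounded below forces \<open>X' \<rightarrow> 0\<close>
  (\<open>velocity_tendsto_zero\<close>), and every cluster point of \<open>x\<close> is critical for \<open>f + \<Phi>\<close>
  (\<open>critical_cluster_point\<close>). Let \<open>h \<ge> 0\<close> be the energy minus its limit. Near a cluster point the
  Kurdyka-Lojasiewicz inequality reads \<open>h powr \<theta> \<le> M * norm X'\<close>, so that
  \<open>(h powr (1 - \<theta>))' \<le> - const * norm X'\<close>: the remaining length of the curve is at most a multiple of
  \<open>h powr (1 - \<theta>)\<close> (\<open>length_bound\<close>). This traps the curve near the cluster point and makes it converge
  (\<open>convergence_from_cluster_point\<close>). The same inequality, squared and combined with dissipation, gives
  \<open>h' \<le> - const * h powr (2 * \<theta>)\<close>. Separating variables there yields extinction of \<open>h\<close> in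
  finite time, exponential decay, or polynomial decay, for \<open>\<theta>\<close> below, equal to, or above \<open>1 / 2\<close>, and the length
  bound turns decay of \<open>h\<close> into decay of the distance to the limit.

  The energy need not be differentiable, because \<open>p\<close> is only Lipschitz and \<open>f\<close> is not smooth. The estimates are
  therefore phrased with upper right Dini derivatives. A continuous function whose upper right Dini derivative is nowhere
  positive is nonincreasing (\<open>upper_dini_nonpos_imp_le\<close>), and no integral or almost everywhere argument occurs.
\<close>

section \<open>Upper right Dini derivatives\<close>

text \<open>\<open>upper_dini_le h t m\<close> says that the upper right Dini derivative of \<open>h\<close> at \<open>t\<close> is at most \<open>m\<close>.
  Spelled out with slack \<open>m' > m\<close> instead of as a \<open>Limsup\<close>, it stays within the reals although the
  derivative itself may be \<open>-\<infinity>\<close>.\<close>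

definition upper_dini_le :: "(real \<Rightarrow> real) \<Rightarrow> real \<Rightarrow> real \<Rightarrow> bool" where
  "upper_dini_le h t m \<longleftrightarrow> (\<forall>m'>m. \<forall>\<^sub>F s in at_right t. h s - h t \<le> m' * (s - t))"

lemma upper_dini_le_mono: "upper_dini_le h t m \<Longrightarrow> m \<le> m' \<Longrightarrow> upper_dini_le h t m'"
  unfolding upper_dini_le_def by auto

lemma upper_dini_le_limit:
  assumes "\<forall>\<^sub>F s in at_right t. h s - h t \<le> R s * (s - t)" and "(R \<longlongrightarrow> m) (at_right t)"
  shows "upper_dini_le h t m"
  unfolding upper_dini_le_def
proof safe
  fix m' assume "m < m'"
  then have "\<forall>\<^sub>F s in at_right t. R s < m'" using assms(2) order_tendstoD(2) by blast
  moreover have "\<forall>\<^sub>F s in at_right t. t < s" by (rule eventually_at_right_less)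
  ultimately show "\<forall>\<^sub>F s in at_right t. h s - h t \<le> m' * (s - t)"
    using assms(1)
  proof eventually_elim
    case (elim s)
    then have "R s * (s - t) \<le> m' * (s - t)" by (intro mult_right_mono) auto
    with elim show ?case by linarith
  qed
qed

lemma upper_dini_le_add:
  assumes "upper_dini_le h t m" "upper_dini_le k t n"
  shows "upper_dini_le (\<lambda>s. h s + k s) t (m + n)"
  unfolding upper_dini_le_def
proof safe
  fix q assume "m + n < q"
  then have "m < m + (q - m - n) / 2" "n < n + (q - m - n) / 2" by auto
  then have "\<forall>\<^sub>F s in at_right t. h s - h t \<le> (m + (q - m - n) / 2) * (s - t)"
    "\<forall>\<^sub>F s in at_right t. k s - k t \<le> (n + (q - m - n) / 2) * (s - t)"
    using assms unfolding upper_dini_le_def by blast+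
  then show "\<forall>\<^sub>F s in at_right t. h s + k s - (h t + k t) \<le> q * (s - t)"
    by eventually_elim (simp add: field_simps)
qed

lemma upper_dini_le_const: "upper_dini_le (\<lambda>s. k) t 0"
  by (rule upper_dini_le_limit[where R = "\<lambda>_. 0"]) auto

lemma upper_dini_le_linear: "upper_dini_le (\<lambda>s. k * s) t k"
  by (rule upper_dini_le_limit[where R = "\<lambda>_. k"]) (auto simp: algebra_simps)

lemma at_right_quotient:
  assumes "(X has_vector_derivative X') (at t within {0..})" "t \<ge> 0"
  shows "((\<lambda>s. (1 / (s - t)) *\<^sub>R (X s - X t)) \<longlongrightarrow> X') (at_right t)"
proof -
  have "(X has_vector_derivative X') (at t within {t<..})"
    using assms by (auto intro: has_vector_derivative_within_subset)
  then have "((\<lambda>s. (1 / norm (s - t)) *\<^sub>R (X s - (X t + (s - t) *\<^sub>R X'))) \<longlongrightarrow> 0) (at_right t)"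
    unfolding has_vector_derivative_def has_derivative_within by auto
  moreover have "\<forall>\<^sub>F s in at_right t. (1 / norm (s - t)) *\<^sub>R (X s - (X t + (s - t) *\<^sub>R X'))
      = (1 / (s - t)) *\<^sub>R (X s - X t) - X'"
    using eventually_at_right_less[of t]
    by eventually_elim (simp add: scaleR_diff_right scaleR_add_right)
  ultimately have "((\<lambda>s. (1 / (s - t)) *\<^sub>R (X s - X t) - X') \<longlongrightarrow> 0) (at_right t)"
    using tendsto_cong by force
  then show ?thesis by (rule LIM_zero_cancel)
qed

lemma upper_dini_le_norm:
  assumes "(X has_vector_derivative X') (at t within {0..})" "t \<ge> 0"
  shows "upper_dini_le (\<lambda>s. norm (X s - v)) t (norm X')"
proof (rule upper_dini_le_limit)
  show "((\<lambda>s. norm ((1 / (s - t)) *\<^sub>R (X s - X t))) \<longlongrightarrow> norm X') (at_right t)"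
    by (intro tendsto_norm at_right_quotient assms)
  show "\<forall>\<^sub>F s in at_right t. norm (X s - v) - norm (X t - v)
      \<le> norm ((1 / (s - t)) *\<^sub>R (X s - X t)) * (s - t)"
    using eventually_at_right_less[of t]
  proof eventually_elim
    case (elim s)
    have "norm (X s - v) - norm (X t - v) \<le> norm (X s - X t)"
      using norm_triangle_ineq2[of "X s - v" "X t - v"] by simp
    with elim show ?case by simp
  qed
qed

text \<open>Caratheodory's form of differentiability writes the increment of \<open>\<psi>\<close> as a slope times the increment
  of \<open>h\<close>. Near \<open>t\<close> the slope is close to \<open>d > 0\<close>, hence positive, so that the upper bound on the
  increment of \<open>h\<close> may be multiplied by it, even where that increment is very negative.\<close>

lemma upper_dini_le_chain:
  assumes h: "upper_dini_le h t m" and cont: "(h \<longlongrightarrow> h t) (at_right t)"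
    and \<psi>: "(\<psi> has_real_derivative d) (at (h t))" and "d > 0"
  shows "upper_dini_le (\<lambda>s. \<psi> (h s)) t (d * m)"
proof -
  obtain g where g: "\<And>z. \<psi> z - \<psi> (h t) = g z * (z - h t)" "isCont g (h t)" "g (h t) = d"
    using \<psi> by (auto simp: CARAT_DERIV)
  have glim: "((\<lambda>s. g (h s)) \<longlongrightarrow> d) (at_right t)"
    using isCont_tendsto_compose[OF g(2) cont] g(3) by simp
  show ?thesis unfolding upper_dini_le_def
  proof safe
    fix q assume "d * m < q"
    then have q: "m < q / d" using \<open>d > 0\<close> by (simp add: field_simps)
    then obtain m' where m': "m < m'" "m' < q / d" using dense by blast
    then have "d * m' < q" using \<open>d > 0\<close> by (simp add: field_simps)
    then have "\<forall>\<^sub>F s in at_right t. g (h s) * m' < q"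
      using order_tendstoD(2)[OF tendsto_mult_right[OF glim]] by (simp add: mult.commute)
    moreover have "\<forall>\<^sub>F s in at_right t. g (h s) > 0" using order_tendstoD(1)[OF glim \<open>d > 0\<close>] .
    moreover have "\<forall>\<^sub>F s in at_right t. h s - h t \<le> m' * (s - t)"
      using h m'(1) unfolding upper_dini_le_def by blast
    moreover have "\<forall>\<^sub>F s in at_right t. t < s" by (rule eventually_at_right_less)
    ultimately show "\<forall>\<^sub>F s in at_right t. \<psi> (h s) - \<psi> (h t) \<le> q * (s - t)"
    proof eventually_elim
      case (elim s)
      have "\<psi> (h s) - \<psi> (h t) = g (h s) * (h s - h t)" using g(1) .
      also have "\<dots> \<le> g (h s) * (m' * (s - t))" using elim by (intro mult_left_mono) auto
      also have "\<dots> = (g (h s) * m') * (s - t)" by simp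
      also have "\<dots> \<le> q * (s - t)" using elim by (intro mult_right_mono) auto
      finally show ?case .
    qed
  qed
qed

text \<open>This replaces the fundamental theorem of calculus. After tilting by \<open>\<epsilon>\<close>, take the last point \<open>r\<close> at
  which \<open>h r \<le> h s + \<epsilon> * (r - s)\<close>; if it came before \<open>t\<close>, the Dini bound at \<open>r\<close> would carry the
  inequality further to the right.\<close>

lemma upper_dini_nonpos_imp_le:
  assumes "s \<le> t" and cont: "continuous_on {s..t} h"
    and dini: "\<And>r. s \<le> r \<Longrightarrow> r < t \<Longrightarrow> upper_dini_le h r 0"
  shows "h t \<le> h s"
proof (rule field_le_epsilon)
  fix e :: real assume "e > 0"
  define \<epsilon> where "\<epsilon> = e / (t - s + 1)"
  have "\<epsilon> > 0" using \<open>e > 0\<close> \<open>s \<le> t\<close> by (simp add: \<epsilon>_def)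
  define k where "k = (\<lambda>r. h r - h s - \<epsilon> * (r - s))"
  have kc: "continuous_on {s..t} k" unfolding k_def by (intro continuous_intros cont)
  define A where "A = {s..t} \<inter> k -` {..0}"
  have "closed A" unfolding A_def
    by (rule continuous_closed_preimage[OF kc]) auto
  then have "compact A"
    using compact_Int_closed[of "{s..t}" A] by (simp add: A_def)
  moreover have "s \<in> A" using \<open>s \<le> t\<close> by (simp add: A_def k_def)
  ultimately obtain r where r: "r \<in> A" "\<And>q. q \<in> A \<Longrightarrow> q \<le> r"
    using compact_attains_sup[of A] by blast
  have "r = t"
  proof (rule ccontr)
    assume "r \<noteq> t"
    then have rt: "s \<le> r" "r < t" using r(1) by (auto simp: A_def)
    have "\<forall>\<^sub>F q in at_right r. h q - h r \<le> \<epsilon> * (q - r)"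
      using dini[OF rt] \<open>\<epsilon> > 0\<close> unfolding upper_dini_le_def by blast
    moreover have "\<forall>\<^sub>F q in at_right r. r < q \<and> q < t"
      using eventually_at_right_real[OF rt(2)] by simp
    ultimately have "\<forall>\<^sub>F q in at_right r. False"
    proof eventually_elim
      case (elim q)
      have "k q \<le> k r" using elim by (simp add: k_def algebra_simps)
      then have "q \<in> A" using r(1) elim rt by (auto simp: A_def)
      then show False using r(2) elim by fastforce
    qed
    then show False by simp
  qed
  then have "h t \<le> h s + \<epsilon> * (t - s)" using r(1) by (simp add: A_def k_def)
  also have "\<epsilon> * (t - s) \<le> e" using \<open>e > 0\<close> \<open>s \<le> t\<close> by (simp add: \<epsilon>_def field_simps)
  finally show "h t \<le> h s + e" by simp
qed

section \<open>Dissipative curves and the Lojasiewicz inequality\<close>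

text \<open>The abstract situation behind the theorem: a curve \<open>X\<close> with velocity \<open>X'\<close>, along which an energy
  \<open>h\<close> drops at least at the rate \<open>c * (norm X')\<^sup>2\<close>. The energy is required to be continuous only,
  because a nonsmooth function enters into it below.\<close>

locale dissipative_curve =
  fixes X X' :: "real \<Rightarrow> 'b::real_normed_vector" and h :: "real \<Rightarrow> real" and c :: real
  assumes c_pos: "c > 0"
    and X_deriv: "\<And>t. t \<ge> 0 \<Longrightarrow> (X has_vector_derivative X' t) (at t within {0..})"
    and h_cont: "continuous_on {0..} h"
    and h_dini: "\<And>t. t \<ge> 0 \<Longrightarrow> upper_dini_le h t (- c * (norm (X' t))\<^sup>2)"
begin

lemma X_cont: "continuous_on {0..} X"
  using X_deriv by (auto intro: continuous_on_vector_derivative)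

lemma h_right_cont: "t \<ge> 0 \<Longrightarrow> (h \<longlongrightarrow> h t) (at_right t)"
  using h_cont by (auto simp: continuous_on_def intro: tendsto_within_subset)

lemma energy_drop:
  assumes "0 \<le> s" "s \<le> t" and "\<And>r. s \<le> r \<Longrightarrow> r < t \<Longrightarrow> v \<le> c * (norm (X' r))\<^sup>2"
  shows "h t + v * (t - s) \<le> h s"
proof -
  have "h t + v * t \<le> h s + v * s"
  proof (rule upper_dini_nonpos_imp_le[OF assms(2)])
    show "continuous_on {s..t} (\<lambda>r. h r + v * r)"
      using assms(1) by (intro continuous_intros continuous_on_subset[OF h_cont]) auto
    fix r assume r: "s \<le> r" "r < t"
    show "upper_dini_le (\<lambda>r. h r + v * r) r 0"
      by (rule upper_dini_le_mono[OF upper_dini_le_add[OF h_dini upper_dini_le_linear]])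
        (use assms r in auto)
  qed
  then show ?thesis by (simp add: algebra_simps)
qed

lemma energy_antimono: "0 \<le> s \<Longrightarrow> s \<le> t \<Longrightarrow> h t \<le> h s"
  using energy_drop[of s t 0] c_pos by simp

text \<open>Barbalat argument: where the velocity is at least \<open>\<epsilon>\<close>, the Lipschitz condition keeps it above
  \<open>\<epsilon> / 2\<close> for a time \<open>\<delta>\<close> that depends on \<open>\<epsilon>\<close> only, which costs a fixed amount of energy. Once the
  energy is close to its infimum, that amount is no longer available.\<close>

lemma velocity_tendsto_zero:
  assumes lip: "\<And>s t. 0 \<le> s \<Longrightarrow> 0 \<le> t \<Longrightarrow> norm (X' s - X' t) \<le> \<Lambda> * \<bar>s - t\<bar>"
    and "\<Lambda> > 0" and bdd: "\<And>t. t \<ge> 0 \<Longrightarrow> m \<le> h t"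
  shows "(X' \<longlongrightarrow> 0) at_top"
proof (rule tendstoI)
  fix \<epsilon> :: real assume "\<epsilon> > 0"
  define \<delta> where "\<delta> = \<epsilon> / (2 * \<Lambda>)"
  have "\<delta> > 0" using \<open>\<epsilon> > 0\<close> \<open>\<Lambda> > 0\<close> by (simp add: \<delta>_def)
  define I where "I = Inf (h ` {0..})"
  have bb: "bdd_below (h ` {0..})" using bdd by (auto intro!: bdd_belowI2)
  have I: "I \<le> h t" if "t \<ge> 0" for t unfolding I_def using that by (auto intro: cInf_lower bb)
  define v where "v = c * (\<epsilon> / 2)\<^sup>2"
  have "v > 0" using c_pos \<open>\<epsilon> > 0\<close> by (simp add: v_def)
  then have "I < I + v * \<delta>" using \<open>\<delta> > 0\<close> by simp
  then obtain T where T: "T \<ge> 0" "h T < I + v * \<delta>"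
    using bb unfolding I_def by (subst (asm) cInf_less_iff) auto
  have "norm (X' t) < \<epsilon>" if "t \<ge> T" for t
  proof (rule ccontr)
    assume big: "\<not> norm (X' t) < \<epsilon>"
    have "h (t + \<delta>) + v * (t + \<delta> - t) \<le> h t"
    proof (rule energy_drop)
      fix r assume r: "t \<le> r" "r < t + \<delta>"
      have "norm (X' r - X' t) \<le> \<Lambda> * \<bar>r - t\<bar>" using r T that by (intro lip) auto
      also have "\<dots> \<le> \<Lambda> * \<delta>" using r \<open>\<Lambda> > 0\<close> by (intro mult_left_mono) auto
      also have "\<dots> = \<epsilon> / 2" using \<open>\<Lambda> > 0\<close> by (simp add: \<delta>_def)
      finally have "\<epsilon> / 2 \<le> norm (X' r)"
        using big norm_triangle_ineq2[of "X' t" "X' r"] by (simp add: norm_minus_commute)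
      then show "v \<le> c * (norm (X' r))\<^sup>2"
        unfolding v_def using c_pos \<open>\<epsilon> > 0\<close> by (intro mult_left_mono power_mono) auto
    qed (use T that \<open>\<delta> > 0\<close> in auto)
    moreover have "h t \<le> h T" using T that by (intro energy_antimono) auto
    moreover have "I \<le> h (t + \<delta>)" using T that \<open>\<delta> > 0\<close> by (intro I) auto
    ultimately show False using T(2) by simp
  qed
  then show "\<forall>\<^sub>F t in at_top. dist (X' t) 0 < \<epsilon>"
    by (auto simp: eventually_at_top_linorder)
qed

lemma energy_along_sequence:
  assumes \<tau>: "filterlim \<tau> at_top sequentially" and lim: "(\<lambda>k. h (\<tau> k)) \<longlonglongrightarrow> e"
  shows "t \<ge> 0 \<Longrightarrow> e \<le> h t" and "(h \<longlongrightarrow> e) at_top"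
proof -
  show ge: "e \<le> h t" if "t \<ge> 0" for t
  proof (rule tendsto_upperbound[OF lim])
    have "\<forall>\<^sub>F k in sequentially. \<tau> k \<ge> t" using \<tau> by (simp add: filterlim_at_top)
    then show "\<forall>\<^sub>F k in sequentially. h (\<tau> k) \<le> h t"
      by eventually_elim (use that in \<open>auto intro: energy_antimono\<close>)
  qed simp
  show "(h \<longlongrightarrow> e) at_top"
  proof (rule order_tendstoI)
    fix q assume "q < e"
    then show "\<forall>\<^sub>F t in at_top. q < h t"
      by (intro eventually_mono[OF eventually_ge_at_top[of 0]] less_le_trans[OF _ ge])
  next
    fix q assume "e < q"
    then have "\<forall>\<^sub>F k in sequentially. h (\<tau> k) < q" by (rule order_tendstoD(2)[OF lim])
    moreover have "\<forall>\<^sub>F k in sequentially. \<tau> k \<ge> 0" using \<tau> by (simp add: filterlim_at_top)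
    ultimately have "\<forall>\<^sub>F k in sequentially. h (\<tau> k) < q \<and> \<tau> k \<ge> 0" by eventually_elim auto
    then obtain k where k: "h (\<tau> k) < q" "\<tau> k \<ge> 0"
      using eventually_happens'[OF sequentially_bot] by blast
    show "\<forall>\<^sub>F t in at_top. h t < q"
      using eventually_ge_at_top[of "\<tau> k"]
    proof eventually_elim
      case (elim t)
      then show ?case using energy_antimono[OF k(2)] k(1) by fastforce
    qed
  qed
qed

lemma shift_energy: "dissipative_curve X X' (\<lambda>t. h t - e) c"
proof
  show "continuous_on {0..} (\<lambda>t. h t - e)" by (intro continuous_intros h_cont)
  fix t :: real assume t: "t \<ge> 0"
  show "(X has_vector_derivative X' t) (at t within {0..})" by (rule X_deriv[OF t])
  show "upper_dini_le (\<lambda>t. h t - e) t (- c * (norm (X' t))\<^sup>2)"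
    using upper_dini_le_add[OF h_dini[OF t] upper_dini_le_const[of "- e"]] by simp
qed (rule c_pos)

end

locale dissipative_curve_nonneg = dissipative_curve +
  assumes h_nonneg: "t \<ge> 0 \<Longrightarrow> h t \<ge> 0"
begin

lemma h_zero_stays: "0 \<le> s \<Longrightarrow> h s = 0 \<Longrightarrow> s \<le> t \<Longrightarrow> h t = 0"
  using energy_antimono[of s t] h_nonneg[of t] by simp

text \<open>An energy that has reached its minimum \<open>0\<close> stays there, which the dissipation inequality allows
  for a curve at rest only.\<close>

lemma h_zero_imp_stationary:
  assumes "t \<ge> 0" "h t = 0"
  shows "X' t = 0"
proof (rule ccontr)
  assume "X' t \<noteq> 0"
  then have neg: "- c * (norm (X' t))\<^sup>2 < 0" using c_pos by simp
  then obtain m where m: "- c * (norm (X' t))\<^sup>2 < m" "m < 0" using dense by blast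
  then have "\<forall>\<^sub>F s in at_right t. h s - h t \<le> m * (s - t)"
    using h_dini[OF assms(1)] unfolding upper_dini_le_def by blast
  moreover have "\<forall>\<^sub>F s in at_right t. t < s" by (rule eventually_at_right_less)
  ultimately have "\<forall>\<^sub>F s in at_right t. False"
  proof eventually_elim
    case (elim s)
    then have "h s < h t" using m(2) by (smt (verit) mult_neg_pos)
    then show False using h_zero_stays[of t s] assms elim by simp
  qed
  then show False by simp
qed

text \<open>The point of the Lojasiewicz inequality: the derivative \<open>(1 - \<theta>) * h powr (- \<theta>)\<close> of the
  desingularizing function is at least a multiple of \<open>1 / norm X'\<close>, so it cancels one of the two factors
  \<open>norm X'\<close> in the dissipation rate. What is left controls the length of the curve.\<close>

lemma dini_desingularized:
  assumes "t \<ge> 0" "0 < \<theta>" "\<theta> < 1" "M > 0" and KL: "h t powr \<theta> \<le> M * norm (X' t)"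
  shows "upper_dini_le (\<lambda>s. h s powr (1 - \<theta>)) t (- ((1 - \<theta>) * c / M * norm (X' t)))"
proof (cases "h t = 0")
  case True
  have "\<forall>\<^sub>F s in at_right t. h s powr (1 - \<theta>) - h t powr (1 - \<theta>) \<le> 0 * (s - t)"
    using eventually_at_right_less[of t]
    by eventually_elim (use True h_zero_stays[OF assms(1) True] in auto)
  then show ?thesis
    using h_zero_imp_stationary[OF assms(1) True]
    by (intro upper_dini_le_limit[where R = "\<lambda>_. 0"]) auto
next
  case False
  then have pos: "h t > 0" using h_nonneg[OF assms(1)] by simp
  define g where "g = norm (X' t)"
  have "h t powr \<theta> > 0" using pos by simp
  then have "M * g > 0" using KL unfolding g_def by linarith
  then have g: "g > 0" using assms by (simp add: zero_less_mult_iff)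
  have d: "((\<lambda>z. z powr (1 - \<theta>)) has_real_derivative (1 - \<theta>) * h t powr (- \<theta>)) (at (h t))"
    using has_real_derivative_powr[OF pos, of "1 - \<theta>"] by simp
  have "upper_dini_le (\<lambda>s. h s powr (1 - \<theta>)) t (((1 - \<theta>) * h t powr (- \<theta>)) * (- c * g\<^sup>2))"
    unfolding g_def
    by (rule upper_dini_le_chain[OF h_dini[OF assms(1)] h_right_cont[OF assms(1)] d])
      (use assms pos in auto)
  moreover have "((1 - \<theta>) * h t powr (- \<theta>)) * (- c * g\<^sup>2) \<le> - ((1 - \<theta>) * c / M * g)"
  proof -
    have "h t powr (- \<theta>) * (M * g) \<ge> 1"
      using KL \<open>h t powr \<theta> > 0\<close> unfolding g_def by (simp add: powr_minus field_simps)
    then have "(1 - \<theta>) * c / M * g * 1 \<le> (1 - \<theta>) * c / M * g * (h t powr (- \<theta>) * (M * g))"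
      using assms c_pos g by (intro mult_left_mono) auto
    also have "\<dots> = (1 - \<theta>) * h t powr (- \<theta>) * (c * g\<^sup>2)"
      using assms by (simp add: power2_eq_square)
    finally show ?thesis by simp
  qed
  ultimately show ?thesis unfolding g_def by (rule upper_dini_le_mono)
qed

text \<open>The distance from \<open>X s\<close> plus a multiple of the desingularized energy is nonincreasing: the second
  term decreases at least as fast as the first one can grow.\<close>

lemma length_bound:
  assumes "0 \<le> s" "s \<le> t" "0 < \<theta>" "\<theta> < 1" "M > 0"
    and KL: "\<And>r. s \<le> r \<Longrightarrow> r < t \<Longrightarrow> h r powr \<theta> \<le> M * norm (X' r)"
  shows "norm (X t - X s) \<le> M / ((1 - \<theta>) * c) * h s powr (1 - \<theta>)"
proof -
  define \<kappa> where "\<kappa> = M / ((1 - \<theta>) * c)"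
  have "\<kappa> > 0" using assms c_pos by (simp add: \<kappa>_def)
  have "norm (X t - X s) + \<kappa> * h t powr (1 - \<theta>) \<le> norm (X s - X s) + \<kappa> * h s powr (1 - \<theta>)"
  proof (rule upper_dini_nonpos_imp_le[OF assms(2)])
    have "continuous_on {s..t} h" "continuous_on {s..t} X"
      using h_cont X_cont assms(1) by (auto intro: continuous_on_subset)
    then show "continuous_on {s..t} (\<lambda>r. norm (X r - X s) + \<kappa> * h r powr (1 - \<theta>))"
      using assms h_nonneg by (intro continuous_intros continuous_on_powr') auto
    fix r assume r: "s \<le> r" "r < t"
    then have r0: "r \<ge> 0" using assms by simp
    have pc: "((\<lambda>q. h q powr (1 - \<theta>)) \<longlongrightarrow> h r powr (1 - \<theta>)) (at_right r)"
      using assms h_right_cont[OF r0] h_nonneg eventually_at_right_less[of r] r0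
      by (intro tendsto_powr') (auto elim!: eventually_mono)
    have "upper_dini_le (\<lambda>q. \<kappa> * h q powr (1 - \<theta>)) r (\<kappa> * (- ((1 - \<theta>) * c / M * norm (X' r))))"
      by (rule upper_dini_le_chain[OF dini_desingularized[OF r0 assms(3-5) KL[OF r]] pc _ \<open>\<kappa> > 0\<close>])
        (auto intro!: derivative_eq_intros)
    then have "upper_dini_le (\<lambda>r. norm (X r - X s) + \<kappa> * h r powr (1 - \<theta>)) r
       (norm (X' r) + \<kappa> * (- ((1 - \<theta>) * c / M * norm (X' r))))"
      by (intro upper_dini_le_add upper_dini_le_norm X_deriv r0)
    moreover have "norm (X' r) + \<kappa> * (- ((1 - \<theta>) * c / M * norm (X' r))) = 0"
      using assms c_pos by (simp add: \<kappa>_def)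
    ultimately show "upper_dini_le (\<lambda>r. norm (X r - X s) + \<kappa> * h r powr (1 - \<theta>)) r 0" by simp
  qed
  moreover have "\<kappa> * h t powr (1 - \<theta>) \<ge> 0" using \<open>\<kappa> > 0\<close> by simp
  ultimately show ?thesis unfolding \<kappa>_def[symmetric] by simp
qed

text \<open>The Lojasiewicz inequality is needed near one cluster point \<open>Z\<close> only, because the curve is trapped
  there: enter the ball of radius \<open>\<rho>\<close> at a time when the distance to \<open>Z\<close> and the length still available
  are both below \<open>\<rho> / 2\<close>. Up to the first exit the inequality holds, hence so does \<open>length_bound\<close>,
  which forbids the exit.\<close>

lemma convergence_from_cluster_point:
  assumes "0 < \<theta>" "\<theta> < 1" "M > 0" "\<rho> > 0" "T \<ge> 0"
    and KL: "\<And>r. r \<ge> T \<Longrightarrow> norm (X r - Z) < \<rho> \<Longrightarrow> h r powr \<theta> \<le> M * norm (X' r)"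
    and h0: "(h \<longlongrightarrow> 0) at_top"
    and \<tau>: "filterlim \<tau> at_top sequentially" and X\<tau>: "(\<lambda>k. X (\<tau> k)) \<longlonglongrightarrow> Z"
  shows "(X \<longlongrightarrow> Z) at_top"
proof -
  define \<kappa> where "\<kappa> = M / ((1 - \<theta>) * c)"
  have "\<kappa> > 0" using assms c_pos by (simp add: \<kappa>_def)
  have "((\<lambda>s. h s powr (1 - \<theta>)) \<longlongrightarrow> 0 powr (1 - \<theta>)) at_top"
    by (rule tendsto_powr'[OF h0 tendsto_const])
      (use assms h_nonneg in \<open>auto intro: eventually_mono[OF eventually_ge_at_top[of 0]]\<close>)
  from tendsto_mult_left[OF this, of \<kappa>]
  have small: "((\<lambda>s. \<kappa> * h s powr (1 - \<theta>)) \<longlongrightarrow> 0) at_top" by simp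
  have "\<forall>\<^sub>F k in sequentially. \<kappa> * h (\<tau> k) powr (1 - \<theta>) < \<rho> / 2"
    using order_tendstoD(2)[OF filterlim_compose[OF small \<tau>], of "\<rho> / 2"] assms by simp
  moreover have "\<forall>\<^sub>F k in sequentially. dist (X (\<tau> k)) Z < \<rho> / 2"
    using tendstoD[OF X\<tau>, of "\<rho> / 2"] assms by simp
  moreover have "\<forall>\<^sub>F k in sequentially. \<tau> k \<ge> T"
    using \<tau> by (simp add: filterlim_at_top)
  ultimately have "\<forall>\<^sub>F k in sequentially. \<kappa> * h (\<tau> k) powr (1 - \<theta>) < \<rho> / 2
      \<and> dist (X (\<tau> k)) Z < \<rho> / 2 \<and> \<tau> k \<ge> T"
    by eventually_elim auto
  then obtain k where k: "\<kappa> * h (\<tau> k) powr (1 - \<theta>) < \<rho> / 2" "dist (X (\<tau> k)) Z < \<rho> / 2" "\<tau> k \<ge> T"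
    using eventually_happens'[OF sequentially_bot] by blast
  define t\<^sub>1 where "t\<^sub>1 = \<tau> k"
  have t1: "t\<^sub>1 \<ge> 0" "t\<^sub>1 \<ge> T" using k(3) assms by (auto simp: t\<^sub>1_def)
  have trapped: "norm (X r - Z) < \<rho>" if "r \<ge> t\<^sub>1" for r
  proof (rule ccontr)
    assume "\<not> norm (X r - Z) < \<rho>"
    \<comment> \<open>The least element of this set is the time of the first exit from the ball.\<close>
    define B where "B = {t\<^sub>1..r} \<inter> (\<lambda>q. norm (X q - Z)) -` {\<rho>..}"
    have "closed B" unfolding B_def
      by (intro continuous_closed_preimage continuous_intros continuous_on_subset[OF X_cont])
        (use t1 in auto)
    then have "compact B"
      using compact_Int_closed[of "{t\<^sub>1..r}" B] by (simp add: B_def)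
    moreover have "r \<in> B" using \<open>\<not> norm (X r - Z) < \<rho>\<close> that by (simp add: B_def)
    ultimately obtain q where q: "q \<in> B" "\<And>s. s \<in> B \<Longrightarrow> q \<le> s"
      using compact_attains_inf[of B] by blast
    have "norm (X q - X t\<^sub>1) \<le> \<kappa> * h t\<^sub>1 powr (1 - \<theta>)" unfolding \<kappa>_def
    proof (rule length_bound)
      fix s assume s: "t\<^sub>1 \<le> s" "s < q"
      then have "s \<notin> B" using q(2) by force
      then have "norm (X s - Z) < \<rho>" using s q(1) by (auto simp: B_def)
      then show "h s powr \<theta> \<le> M * norm (X' s)" using s t1 by (intro KL) auto
    qed (use t1 q(1) assms in \<open>auto simp: B_def\<close>)
    then have "norm (X q - Z) < \<rho>"
      using k(1,2) norm_triangle_ineq[of "X q - X t\<^sub>1" "X t\<^sub>1 - Z"]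
      by (simp add: t\<^sub>1_def dist_norm)
    then show False using q(1) by (auto simp: B_def)
  qed
  have bound: "norm (Z - X s) \<le> \<kappa> * h s powr (1 - \<theta>)" if "s \<ge> t\<^sub>1" for s
  proof (rule tendsto_upperbound)
    show "(\<lambda>k. norm (X (\<tau> k) - X s)) \<longlonglongrightarrow> norm (Z - X s)" by (intro tendsto_intros X\<tau>)
    have "\<forall>\<^sub>F k in sequentially. \<tau> k \<ge> s" using \<tau> by (simp add: filterlim_at_top)
    then show "\<forall>\<^sub>F k in sequentially. norm (X (\<tau> k) - X s) \<le> \<kappa> * h s powr (1 - \<theta>)"
      unfolding \<kappa>_def
      by eventually_elim (rule length_bound, use that t1 assms trapped in auto)
  qed auto
  have "((\<lambda>s. X s - Z) \<longlongrightarrow> 0) at_top"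
  proof (rule Lim_null_comparison[OF _ small])
    show "\<forall>\<^sub>F s in at_top. norm (X s - Z) \<le> \<kappa> * h s powr (1 - \<theta>)"
      using eventually_ge_at_top[of t\<^sub>1]
      by eventually_elim (use bound in \<open>simp add: norm_minus_commute\<close>)
  qed
  then show ?thesis by (rule LIM_zero_cancel)
qed

end

section \<open>Rates of convergence from the Lojasiewicz inequality\<close>

text \<open>The situation from some time \<open>T\<close> on, once convergence is known: the curve lives where the Lojasiewicz
  inequality holds.\<close>

locale Lojasiewicz_curve = dissipative_curve_nonneg +
  fixes \<theta> M T :: real and Z
  assumes \<theta>: "0 < \<theta>" "\<theta> < 1" and M_pos: "M > 0" and T_nonneg: "T \<ge> 0"
    and KL: "r \<ge> T \<Longrightarrow> h r powr \<theta> \<le> M * norm (X' r)"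
    and X_lim: "(X \<longlongrightarrow> Z) at_top"
begin

lemma distance_le_energy:
  assumes "s \<ge> T"
  shows "norm (X s - Z) \<le> M / ((1 - \<theta>) * c) * h s powr (1 - \<theta>)"
proof (rule tendsto_upperbound)
  show "((\<lambda>t. norm (X s - X t)) \<longlongrightarrow> norm (X s - Z)) at_top" by (intro tendsto_intros X_lim)
  show "\<forall>\<^sub>F t in at_top. norm (X s - X t) \<le> M / ((1 - \<theta>) * c) * h s powr (1 - \<theta>)"
    using eventually_ge_at_top[of s]
  proof eventually_elim
    case (elim t)
    have "norm (X t - X s) \<le> M / ((1 - \<theta>) * c) * h s powr (1 - \<theta>)"
      by (rule length_bound[OF _ elim \<theta> M_pos KL]) (use assms T_nonneg in auto)
    then show ?case by (subst norm_minus_commute)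
  qed
qed auto

lemma dini_energy:
  assumes "t \<ge> T"
  shows "upper_dini_le h t (- (c / M\<^sup>2) * h t powr (2 * \<theta>))"
proof (rule upper_dini_le_mono[OF h_dini])
  have "(h t powr \<theta>)\<^sup>2 \<le> (M * norm (X' t))\<^sup>2" using KL[OF assms] by (intro power_mono) auto
  moreover have "(h t powr \<theta>)\<^sup>2 = h t powr (2 * \<theta>)"
    by (simp add: power2_eq_square powr_add[symmetric])
  ultimately have "h t powr (2 * \<theta>) / M\<^sup>2 \<le> (norm (X' t))\<^sup>2"
    using M_pos by (simp add: divide_le_eq power_mult_distrib mult.commute)
  then have "c * (h t powr (2 * \<theta>) / M\<^sup>2) \<le> c * (norm (X' t))\<^sup>2"
    using c_pos by (intro mult_left_mono) auto
  then show "- c * (norm (X' t))\<^sup>2 \<le> - (c / M\<^sup>2) * h t powr (2 * \<theta>)" by simp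
qed (use assms T_nonneg in auto)

text \<open>The energy obeys \<open>h' \<le> - (c / M\<^sup>2) * h powr (2 * \<theta>)\<close> in the sense of Dini derivatives. Separation
  of variables asks for a primitive \<open>\<psi>\<close> of \<open>k * z powr (- (2 * \<theta>))\<close>; then \<open>\<psi> \<circ> h\<close> decreases at least linearly. The three
  regimes of the convergence rate are the three shapes of \<open>\<psi>\<close>: a positive power, the logarithm,
  the negative of a negative power.\<close>

lemma transformed_energy_decay:
  assumes "t \<ge> T" "h t > 0"
    and \<psi>: "\<And>z. z > 0 \<Longrightarrow> (\<psi> has_real_derivative k * z powr (- (2 * \<theta>))) (at z)" and "k > 0"
  shows "\<psi> (h t) + k * c / M\<^sup>2 * (t - T) \<le> \<psi> (h T)"
proof -
  define v where "v = k * c / M\<^sup>2"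
  have pos: "h r > 0" if "T \<le> r" "r \<le> t" for r
    using energy_antimono[of r t] that T_nonneg assms(2) by simp
  have "\<psi> (h t) + v * t \<le> \<psi> (h T) + v * T"
  proof (rule upper_dini_nonpos_imp_le[OF assms(1)])
    have hc: "continuous_on {T..t} h" using h_cont T_nonneg by (auto intro: continuous_on_subset)
    have "continuous_on {0<..} \<psi>"
      by (intro continuous_at_imp_continuous_on ballI DERIV_isCont[OF \<psi>]) simp
    then have "continuous_on {T..t} (\<lambda>r. \<psi> (h r))"
      by (rule continuous_on_compose2[OF _ hc]) (use pos in auto)
    then show "continuous_on {T..t} (\<lambda>r. \<psi> (h r) + v * r)" by (intro continuous_intros)
    fix r assume r: "T \<le> r" "r < t"
    then have hr: "h r > 0" "r \<ge> 0" using pos T_nonneg by auto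
    have "upper_dini_le (\<lambda>s. \<psi> (h s)) r
        ((k * h r powr (- (2 * \<theta>))) * (- (c / M\<^sup>2) * h r powr (2 * \<theta>)))"
      by (rule upper_dini_le_chain[OF dini_energy[OF r(1)] h_right_cont[OF hr(2)] \<psi>[OF hr(1)]])
        (use hr assms in auto)
    also have "(k * h r powr (- (2 * \<theta>))) * (- (c / M\<^sup>2) * h r powr (2 * \<theta>)) = - v"
      using hr by (simp add: v_def powr_minus)
    finally have "upper_dini_le (\<lambda>r. \<psi> (h r) + v * r) r (- v + v)"
      by (intro upper_dini_le_add upper_dini_le_linear)
    then show "upper_dini_le (\<lambda>r. \<psi> (h r) + v * r) r 0" by simp
  qed
  moreover have "v * (t - T) = v * t - v * T" by (rule right_diff_distrib)
  ultimately show ?thesis unfolding v_def by linarith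
qed

lemma finite_time_convergence:
  assumes "\<theta> < 1 / 2"
  shows "\<exists>S\<ge>0. \<forall>s\<ge>S. X s = X S"
proof -
  define k where "k = (1 - 2 * \<theta>) * c / M\<^sup>2"
  have "k > 0" using assms c_pos M_pos by (simp add: k_def)
  define S where "S = T + (h T powr (1 - 2 * \<theta>) + 1) / k"
  have "S \<ge> T" using \<open>k > 0\<close> by (simp add: S_def)
  \<comment> \<open>At time \<open>S\<close> the positive quantity \<open>h powr (1 - 2 * \<theta>)\<close> would have dropped below \<open>0\<close>.\<close>
  have "h S = 0"
  proof (rule ccontr)
    assume "h S \<noteq> 0"
    then have pos: "h S > 0" using h_nonneg[of S] \<open>S \<ge> T\<close> T_nonneg by simp
    have "h S powr (1 - 2 * \<theta>) + k * (S - T) \<le> h T powr (1 - 2 * \<theta>)"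
      unfolding k_def
    proof (rule transformed_energy_decay[OF \<open>S \<ge> T\<close> pos])
      fix z :: real assume "z > 0"
      then show "((\<lambda>z. z powr (1 - 2 * \<theta>)) has_real_derivative (1 - 2 * \<theta>) * z powr - (2 * \<theta>)) (at z)"
        using has_real_derivative_powr[of z "1 - 2 * \<theta>"] by simp
    qed (use assms in auto)
    moreover have "k * (S - T) = h T powr (1 - 2 * \<theta>) + 1" using \<open>k > 0\<close> by (simp add: S_def)
    ultimately show False using powr_ge_zero[of "h S" "1 - 2 * \<theta>"] by linarith
  qed
  have "X s = X S" if "s \<ge> S" for s
  proof -
    have "norm (X s - X S) \<le> M / ((1 - \<theta>) * c) * h S powr (1 - \<theta>)"
      by (rule length_bound[OF _ that \<theta> M_pos KL]) (use \<open>S \<ge> T\<close> T_nonneg in auto)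
    then show ?thesis using \<open>h S = 0\<close> by simp
  qed
  then show ?thesis using \<open>S \<ge> T\<close> T_nonneg by (meson order_trans)
qed

lemma exponential_rate:
  assumes "\<theta> = 1 / 2" and "N > 0"
  shows "\<exists>A>0. \<exists>B>0. \<forall>t\<ge>T. N * norm (X t - Z) \<le> A * exp (- B * t)"
proof -
  define k where "k = c / M\<^sup>2"
  have "k > 0" using c_pos M_pos by (simp add: k_def)
  define \<kappa> where "\<kappa> = M / ((1 - \<theta>) * c)"
  have "\<kappa> > 0" using \<theta> c_pos M_pos by (simp add: \<kappa>_def)
  define A where "A = N * \<kappa> * sqrt (h T) * exp (k / 2 * T) + 1"
  have "A > 0" using \<open>\<kappa> > 0\<close> assms h_nonneg[of T] T_nonneg by (simp add: A_def add_nonneg_pos)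
  have "N * norm (X t - Z) \<le> A * exp (- (k / 2) * t)" if "t \<ge> T" for t
  proof -
    have "h t \<le> h T * exp (- k * (t - T))"
    proof (cases "h t > 0")
      case True
      have "h T > 0" using energy_antimono[of T t] that T_nonneg True by simp
      have "ln (h t) + 1 * c / M\<^sup>2 * (t - T) \<le> ln (h T)"
        by (rule transformed_energy_decay[OF that True])
          (use assms in \<open>auto intro!: derivative_eq_intros simp: powr_minus field_simps\<close>)
      then have "ln (h t) \<le> ln (h T) + - k * (t - T)" by (simp add: k_def)
      then have "exp (ln (h t)) \<le> exp (ln (h T) + - k * (t - T))" by (simp only: exp_le_cancel_iff)
      then show ?thesis using True \<open>h T > 0\<close> by (simp add: exp_add[of "ln (h T)" "- k * (t - T)", simplified])
    next
      case False
      have "0 \<le> h T * exp (- k * (t - T))" using h_nonneg[of T] T_nonneg by simp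
      then show ?thesis using False by linarith
    qed
    then have "sqrt (h t) \<le> sqrt (h T * exp (- k * (t - T)))" by simp
    also have "\<dots> = sqrt (h T) * exp (- (k / 2) * (t - T))"
    proof -
      have "exp (- k * (t - T)) = (exp (- (k / 2) * (t - T)))\<^sup>2"
        by (simp add: exp_double[symmetric])
      then show ?thesis by (simp add: real_sqrt_mult)
    qed
    finally have "sqrt (h t) \<le> sqrt (h T) * exp (- (k / 2) * (t - T))" .
    then have sq: "sqrt (h t) \<le> sqrt (h T) * exp (k / 2 * T) * exp (- (k / 2) * t)"
    proof -
      have "exp (- (k / 2) * (t - T)) = exp (k / 2 * T) * exp (- (k / 2) * t)"
        by (simp add: exp_add[symmetric] right_diff_distrib)
      then show ?thesis using \<open>sqrt (h t) \<le> sqrt (h T) * exp (- (k / 2) * (t - T))\<close>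
        by (simp only: mult.assoc)
    qed
    have "norm (X t - Z) \<le> \<kappa> * sqrt (h t)"
      using distance_le_energy[OF that] h_nonneg[of t] that T_nonneg
      unfolding \<kappa>_def[symmetric] by (simp add: powr_half_sqrt assms(1))
    also have "\<dots> \<le> \<kappa> * (sqrt (h T) * exp (k / 2 * T) * exp (- (k / 2) * t))"
      using sq \<open>\<kappa> > 0\<close> by (intro mult_left_mono) auto
    finally have "N * norm (X t - Z) \<le> N * (\<kappa> * (sqrt (h T) * exp (k / 2 * T) * exp (- (k / 2) * t)))"
      using assms(2) by simp
    also have "\<dots> = (A - 1) * exp (- (k / 2) * t)" by (simp add: A_def)
    also have "\<dots> \<le> A * exp (- (k / 2) * t)" by (intro mult_right_mono) auto
    finally show ?thesis .
  qed
  then show ?thesis using \<open>A > 0\<close> \<open>k > 0\<close>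
    by (intro exI[of _ A] conjI exI[of _ "k / 2"]) auto
qed

lemma polynomial_rate:
  assumes "\<theta> > 1 / 2" and "N > 0"
  shows "\<exists>A>0. \<exists>B>0. \<forall>t\<ge>2 * T + 1.
    N * norm (X t - Z) \<le> (A * t + B) powr (- ((1 - \<theta>) / (2 * \<theta> - 1)))"
proof -
  define k where "k = (2 * \<theta> - 1) * c / M\<^sup>2"
  have "k > 0" using assms c_pos M_pos by (simp add: k_def)
  define \<kappa> where "\<kappa> = M / ((1 - \<theta>) * c)"
  have "\<kappa> > 0" using \<theta> c_pos M_pos by (simp add: \<kappa>_def)
  define \<beta> where "\<beta> = (1 - \<theta>) / (2 * \<theta> - 1)"
  have "\<beta> > 0" using assms \<theta> by (simp add: \<beta>_def)
  \<comment> \<open>The factor \<open>N * \<kappa>\<close> is moved inside the power; \<open>t \<ge> 2 * T + 1\<close> lets \<open>k / 2 * (t + 1)\<close> replace \<open>k * (t - T)\<close>.\<close>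
  define A where "A = k / 2 * (N * \<kappa>) powr (- (1 / \<beta>))"
  have "A > 0" using \<open>k > 0\<close> \<open>\<kappa> > 0\<close> assms by (simp add: A_def)
  have "N * norm (X t - Z) \<le> (A * t + A) powr (- \<beta>)" if "t \<ge> 2 * T + 1" for t
  proof (cases "h t > 0")
    case False
    have tT: "t \<ge> T" using that T_nonneg by simp
    then have "h t = 0" using False h_nonneg[of t] T_nonneg by simp
    then show ?thesis using distance_le_energy[OF tT] by simp
  next
    case True
    have tT: "t \<ge> T" using that T_nonneg by simp
    have "- (h t powr (1 - 2 * \<theta>)) + k * (t - T) \<le> - (h T powr (1 - 2 * \<theta>))"
      unfolding k_def
    proof (rule transformed_energy_decay[OF tT True])
      fix z :: real assume "z > 0"
      then show "((\<lambda>z. - (z powr (1 - 2 * \<theta>))) has_real_derivative (2 * \<theta> - 1) * z powr - (2 * \<theta>)) (at z)"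
        using DERIV_minus[OF has_real_derivative_powr[of z "1 - 2 * \<theta>"]]
        by (simp add: algebra_simps)
    qed (use assms in auto)
    then have "k * (t - T) \<le> h t powr (1 - 2 * \<theta>)"
      using powr_ge_zero[of "h T" "1 - 2 * \<theta>"] by linarith
    moreover have "k * (t - T) \<ge> k / 2 * (t + 1)"
    proof -
      have "k * (t - T) - k / 2 * (t + 1) = k / 2 * (t - 2 * T - 1)" by (simp add: field_simps)
      also have "\<dots> \<ge> 0" using \<open>k > 0\<close> that by simp
      finally show ?thesis by simp
    qed
    ultimately have le: "k / 2 * (t + 1) \<le> h t powr (1 - 2 * \<theta>)" by linarith
    have pos: "k / 2 * (t + 1) > 0" using \<open>k > 0\<close> tT T_nonneg by simp
    have "(1 - 2 * \<theta>) * (- \<beta>) = (2 * \<theta> - 1) * \<beta>" by (simp add: algebra_simps)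
    also have "\<dots> = 1 - \<theta>" using assms by (simp add: \<beta>_def)
    finally have "h t powr (1 - \<theta>) = (h t powr (1 - 2 * \<theta>)) powr (- \<beta>)"
      by (simp add: powr_powr)
    also have "\<dots> \<le> (k / 2 * (t + 1)) powr (- \<beta>)"
      using pos le \<open>\<beta> > 0\<close> by (intro powr_mono2') auto
    finally have "\<kappa> * h t powr (1 - \<theta>) \<le> \<kappa> * (k / 2 * (t + 1)) powr (- \<beta>)"
      using \<open>\<kappa> > 0\<close> by (intro mult_left_mono) auto
    then have "norm (X t - Z) \<le> \<kappa> * (k / 2 * (t + 1)) powr (- \<beta>)"
      using distance_le_energy[OF tT] unfolding \<kappa>_def[symmetric] by linarith
    then have "N * norm (X t - Z) \<le> N * \<kappa> * (k / 2 * (t + 1)) powr (- \<beta>)"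
      using assms by simp
    also have "N * \<kappa> = ((N * \<kappa>) powr (- (1 / \<beta>))) powr (- \<beta>)"
      using \<open>\<beta> > 0\<close> \<open>\<kappa> > 0\<close> assms by (simp add: powr_powr)
    also have "\<dots> * (k / 2 * (t + 1)) powr (- \<beta>)
        = ((N * \<kappa>) powr (- (1 / \<beta>)) * (k / 2 * (t + 1))) powr (- \<beta>)"
      by (rule powr_mult[symmetric])
    also have "(N * \<kappa>) powr (- (1 / \<beta>)) * (k / 2 * (t + 1)) = A * t + A"
      unfolding A_def by (simp only: distrib_left distrib_right mult_1_right mult_1_left mult_ac)
    finally show ?thesis .
  qed
  then show ?thesis using \<open>A > 0\<close> unfolding \<beta>_def
    by (intro exI[of _ A] conjI) auto
qed

end

section \<open>Lower semicontinuous functions\<close>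

lemma lsc_fun_iff:
  "lsc_fun g \<longleftrightarrow> (\<forall>x. \<forall>c<g x. \<forall>\<^sub>F z in nhds x. c < g z)"
  by (auto simp: lsc_fun_def le_Liminf_iff eventually_nhds_conv_at)

lemma lsc_fun_sequence_le:
  fixes g :: "'a::topological_space \<Rightarrow> ereal"
  assumes "lsc_fun g" "X \<longlonglongrightarrow> x" "\<forall>\<^sub>F k in sequentially. g (X k) \<le> c k" "c \<longlonglongrightarrow> l"
  shows "g x \<le> l"
proof (rule ccontr)
  assume "\<not> g x \<le> l"
  then have "l < g x" by simp
  then obtain m where m: "l < m" "m < g x" using dense[of l "g x"] by blast
  then have "\<forall>\<^sub>F z in nhds x. m < g z" using assms(1) by (auto simp: lsc_fun_iff)
  then have "\<forall>\<^sub>F k in sequentially. m < g (X k)"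
    using assms(2) unfolding filterlim_iff by blast
  moreover have "\<forall>\<^sub>F k in sequentially. c k < m" using assms(4) m(1) by (rule order_tendstoD)
  ultimately have "\<forall>\<^sub>F k in sequentially. False"
    using assms(3) by eventually_elim auto
  then show False by simp
qed

lemma lsc_fun_add_continuous:
  fixes f :: "'a::topological_space \<Rightarrow> ereal"
  assumes "lsc_fun f" and q: "continuous_on UNIV q"
  shows "lsc_fun (\<lambda>u. f u + ereal (q u))"
  unfolding lsc_fun_iff
proof (intro allI impI)
  fix x and y assume y: "y < f x + ereal (q x)"
  then have "y - ereal (q x) < f x" by (simp add: ereal_minus_less_iff)
  then obtain c where c: "y - ereal (q x) < ereal c" "ereal c < f x" using ereal_dense2 by blast
  have "\<forall>\<^sub>F z in nhds x. ereal c < f z" using assms(1) c(2) by (auto simp: lsc_fun_iff)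
  moreover have "\<forall>\<^sub>F z in nhds x. y < ereal (c + q z)"
  proof -
    have "y < ereal (c + q x)" using c(1) by (cases y) (auto simp: algebra_simps)
    moreover have "((\<lambda>z. ereal (c + q z)) \<longlongrightarrow> ereal (c + q x)) (nhds x)"
      using q by (intro tendsto_intros) (auto simp: continuous_on_def tendsto_at_iff_tendsto_nhds)
    ultimately show ?thesis using order_tendstoD(1) by blast
  qed
  ultimately show "\<forall>\<^sub>F z in nhds x. y < f z + ereal (q z)"
  proof eventually_elim
    case (elim z)
    then have "ereal (c + q z) \<le> f z + ereal (q z)"
      by (cases "f z") auto
    with elim(2) show ?case by (rule less_le_trans)
  qed
qed

text \<open>The direct method: the sublevel set of \<open>u\<^sub>0\<close> is bounded, so a minimizing sequence has a convergent
  subsequence, and lower semicontinuity passes to the limit.\<close>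

lemma lsc_fun_attains_min:
  fixes g :: "'a::{real_normed_vector,heine_borel} \<Rightarrow> ereal"
  assumes "lsc_fun g" and R: "\<And>u. g u \<le> g u\<^sub>0 \<Longrightarrow> norm u \<le> R"
  shows "\<exists>p. \<forall>u. g p \<le> g u"
proof (cases "Inf (range g) = g u\<^sub>0")
  case True
  then show ?thesis by (metis INF_lower UNIV_I)
next
  case False
  then have less: "Inf (range g) < g u\<^sub>0" by (simp add: INF_lower order_less_le)
  obtain s where s: "\<And>n. s n \<in> range g" "s \<longlonglongrightarrow> Inf (range g)"
    using Inf_as_limit[of "range g"] by auto
  then have "\<forall>n. \<exists>u. s n = g u" by blast
  then obtain U where U: "\<And>n. s n = g (U n)" by (auto dest: choice)
  obtain N where N: "\<And>n. n \<ge> N \<Longrightarrow> s n < g u\<^sub>0"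
    using order_tendstoD(2)[OF s(2) less] by (auto simp: eventually_sequentially)
  have "\<forall>n. U (n + N) \<in> cball 0 R" using N U R by (simp add: less_imp_le)
  then obtain p r where r: "strict_mono r" "((\<lambda>n. U (n + N)) \<circ> r) \<longlonglongrightarrow> p"
    using compact_cball[of "0 :: 'a" R, unfolded compact_def, rule_format, of "\<lambda>n. U (n + N)"]
    by blast
  have "(\<lambda>n. s (n + N)) \<longlonglongrightarrow> Inf (range g)" using s(2) by (rule LIMSEQ_ignore_initial_segment)
  then have "((\<lambda>n. s (n + N)) \<circ> r) \<longlonglongrightarrow> Inf (range g)" using r(1) by (rule LIMSEQ_subseq_LIMSEQ)
  then have "g p \<le> Inf (range g)"
    using U by (intro lsc_fun_sequence_le[OF assms(1) r(2)]) auto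
  then show ?thesis by (meson INF_lower UNIV_I order_trans)
qed

section \<open>Convex, Frechet and limiting subgradients\<close>

text \<open>The subgradients of convex analysis, defined by a global affine minorant. Along the flow they are
  easier to handle than the two subdifferentials defined by limits, to which
  \<open>quadratic_minorant_imp_frechet_subdiff\<close> and \<open>frechet_subdiff_imp_limiting_subdiff\<close> lead back.\<close>

definition convex_subgradient :: "('a::real_inner \<Rightarrow> ereal) \<Rightarrow> 'a \<Rightarrow> 'a \<Rightarrow> bool" where
  "convex_subgradient f p \<xi> \<longleftrightarrow>
     \<bar>f p\<bar> \<noteq> \<infinity> \<and> (\<forall>u. f p + ereal (\<xi> \<bullet> (u - p)) \<le> f u)"

lemma convex_subgradient_le:
  assumes "convex_subgradient f p \<xi>" "convex_subgradient f q \<zeta>"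
  shows "real_of_ereal (f p) + \<xi> \<bullet> (q - p) \<le> real_of_ereal (f q)"
  using assms unfolding convex_subgradient_def
  by (cases "f p"; cases "f q") (auto dest: spec[of _ q])

lemma convex_subgradient_monotone:
  assumes "convex_subgradient f p \<xi>" "convex_subgradient f q \<zeta>"
  shows "0 \<le> (\<xi> - \<zeta>) \<bullet> (p - q)"
  using convex_subgradient_le[OF assms] convex_subgradient_le[OF assms(2,1)]
  by (simp add: inner_diff_left inner_diff_right)

text \<open>The graph of the convex subdifferential is closed, and function values converge along it: lower
  semicontinuity bounds \<open>f\<close> from below in the limit, the subgradient inequality at \<open>P k\<close>, tested with
  \<open>p\<close>, from above.\<close>

lemma convex_subgradient_limit:
  assumes "lsc_fun f" "proper_fun f" and sub: "\<And>k. convex_subgradient f (P k) (\<Xi> k)"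
    and P: "P \<longlonglongrightarrow> p" and \<Xi>: "\<Xi> \<longlonglongrightarrow> \<xi>"
  shows "convex_subgradient f p \<xi>" and "(\<lambda>k. real_of_ereal (f (P k))) \<longlonglongrightarrow> real_of_ereal (f p)"
proof -
  have ineq: "f p + ereal (\<xi> \<bullet> (u - p)) \<le> f u" for u
  proof -
    have "f (P k) \<le> f u - ereal (\<Xi> k \<bullet> (u - P k))" for k
      using sub[of k] by (auto simp: convex_subgradient_def ereal_le_minus)
    moreover have "(\<lambda>k. f u - ereal (\<Xi> k \<bullet> (u - P k))) \<longlonglongrightarrow> f u - ereal (\<xi> \<bullet> (u - p))"
      by (intro tendsto_diff_ereal_general tendsto_intros P \<Xi>) auto
    ultimately have "f p \<le> f u - ereal (\<xi> \<bullet> (u - p))"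
      by (intro lsc_fun_sequence_le[OF assms(1) P]) auto
    then show ?thesis by (simp add: ereal_le_minus)
  qed
  obtain u\<^sub>0 where "f u\<^sub>0 < \<infinity>" using assms(2) by (auto simp: proper_fun_def)
  then have fin: "\<bar>f p\<bar> \<noteq> \<infinity>"
    using ineq[of u\<^sub>0] assms(2) by (cases "f p") (auto simp: proper_fun_def)
  then show sg: "convex_subgradient f p \<xi>" using ineq by (simp add: convex_subgradient_def)
  have "(\<lambda>k. f (P k)) \<longlonglongrightarrow> f p"
  proof (rule order_tendstoI)
    fix c assume "c < f p"
    then have "\<forall>\<^sub>F z in nhds p. c < f z" using assms(1) by (auto simp: lsc_fun_iff)
    then show "\<forall>\<^sub>F k in sequentially. c < f (P k)"
      using P unfolding filterlim_iff by blast
  next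
    fix c assume "f p < c"
    moreover have "(\<lambda>k. f p - ereal (\<Xi> k \<bullet> (p - P k))) \<longlonglongrightarrow> f p - ereal (\<xi> \<bullet> (p - p))"
      by (intro tendsto_diff_ereal_general tendsto_intros P \<Xi>) auto
    ultimately have "\<forall>\<^sub>F k in sequentially. f p - ereal (\<Xi> k \<bullet> (p - P k)) < c"
      by (intro order_tendstoD(2)) auto
    then show "\<forall>\<^sub>F k in sequentially. f (P k) < c"
    proof eventually_elim
      case (elim k)
      have "f (P k) \<le> f p - ereal (\<Xi> k \<bullet> (p - P k))"
        using sub[of k] by (auto simp: convex_subgradient_def ereal_le_minus)
      then show ?case using elim by (rule le_less_trans)
    qed
  qed
  then show "(\<lambda>k. real_of_ereal (f (P k))) \<longlonglongrightarrow> real_of_ereal (f p)"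
    using fin by (intro lim_real_of_ereal) (simp add: ereal_real)
qed

text \<open>Compare \<open>p\<close> with the points \<open>(1 - t) *\<^sub>R p + t *\<^sub>R u\<close>: convexity makes \<open>f\<close> at most affine in \<open>t\<close>, the square
  contributes a term of order \<open>t\<^sup>2\<close>, which disappears after division by \<open>t\<close> as \<open>t \<rightarrow> 0\<close>.\<close>

lemma proximal_minimizer_subgradient:
  assumes "\<gamma> > 0" "proper_fun f" "convex_fun f"
    and min: "\<And>u. f p + ereal (1 / (2 * \<gamma>) * (norm (p - v))\<^sup>2) \<le> f u + ereal (1 / (2 * \<gamma>) * (norm (u - v))\<^sup>2)"
  shows "convex_subgradient f p ((1 / \<gamma>) *\<^sub>R (v - p))"
proof -
  obtain u\<^sub>0 where "f u\<^sub>0 < \<infinity>" using assms(2) by (auto simp: proper_fun_def)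
  then obtain \<alpha> where \<alpha>: "f p = ereal \<alpha>"
    using min[of u\<^sub>0] assms(2) by (cases "f p"; cases "f u\<^sub>0") (auto simp: proper_fun_def)
  have "f p + ereal (((1 / \<gamma>) *\<^sub>R (v - p)) \<bullet> (u - p)) \<le> f u" for u
  proof (cases "f u")
    case (real \<beta>)
    have le: "\<alpha> - \<beta> \<le> (1 / \<gamma>) * ((p - v) \<bullet> (u - p)) + t / (2 * \<gamma>) * (norm (u - p))\<^sup>2"
      if t: "0 < t" "t < 1" for t
    proof -
      define w where "w = (1 - t) *\<^sub>R p + t *\<^sub>R u"
      have "f w \<le> ereal (1 - t) * f p + ereal t * f u"
        using assms(3) t unfolding convex_fun_def w_def by simp
      then obtain \<delta> where \<delta>: "f w = ereal \<delta>" "\<delta> \<le> (1 - t) * \<alpha> + t * \<beta>"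
        using assms(2) \<alpha> real by (cases "f w") (auto simp: proper_fun_def)
      have wv: "w - v = (p - v) + t *\<^sub>R (u - p)" by (simp add: w_def algebra_simps)
      have "(norm (w - v))\<^sup>2 = (norm (p - v))\<^sup>2 + 2 * t * ((p - v) \<bullet> (u - p)) + t\<^sup>2 * (norm (u - p))\<^sup>2"
        unfolding wv by (simp only: power2_norm_eq_inner)
          (simp add: inner_add_left inner_add_right inner_commute power2_eq_square)
      moreover have "\<alpha> + 1 / (2 * \<gamma>) * (norm (p - v))\<^sup>2 \<le> \<delta> + 1 / (2 * \<gamma>) * (norm (w - v))\<^sup>2"
        using min[of w] \<alpha> \<delta> by simp
      ultimately have "\<alpha> + 1 / (2 * \<gamma>) * (norm (p - v))\<^sup>2 \<le> \<delta> + 1 / (2 * \<gamma>) * (norm (p - v))\<^sup>2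
          + 1 / (2 * \<gamma>) * (2 * t * ((p - v) \<bullet> (u - p)) + t\<^sup>2 * (norm (u - p))\<^sup>2)"
        by (simp only: distrib_left add.assoc)
      moreover have "(1 - t) * \<alpha> + t * \<beta> = \<alpha> - t * (\<alpha> - \<beta>)" by (simp add: algebra_simps)
      ultimately have "t * (\<alpha> - \<beta>) \<le> 1 / (2 * \<gamma>) * (2 * t * ((p - v) \<bullet> (u - p)) + t\<^sup>2 * (norm (u - p))\<^sup>2)"
        using \<delta>(2) by linarith
      also have "\<dots> = t * ((1 / \<gamma>) * ((p - v) \<bullet> (u - p)) + t / (2 * \<gamma>) * (norm (u - p))\<^sup>2)"
        using assms(1) by (simp add: field_simps power2_eq_square)
      finally show ?thesis using t by simp
    qed
    have "\<alpha> - \<beta> \<le> (1 / \<gamma>) * ((p - v) \<bullet> (u - p)) + 0 / (2 * \<gamma>) * (norm (u - p))\<^sup>2"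
    proof (rule tendsto_lowerbound)
      show "((\<lambda>t. (1 / \<gamma>) * ((p - v) \<bullet> (u - p)) + t / (2 * \<gamma>) * (norm (u - p))\<^sup>2) \<longlongrightarrow>
        (1 / \<gamma>) * ((p - v) \<bullet> (u - p)) + 0 / (2 * \<gamma>) * (norm (u - p))\<^sup>2) (at_right 0)"
        using assms(1) by (intro tendsto_intros) auto
      have "\<forall>\<^sub>F t::real in at_right 0. t \<in> {0<..<1}" by (rule eventually_at_right_real) simp
      then show "\<forall>\<^sub>F t in at_right 0. \<alpha> - \<beta> \<le> (1 / \<gamma>) * ((p - v) \<bullet> (u - p)) + t / (2 * \<gamma>) * (norm (u - p))\<^sup>2"
        by eventually_elim (use le in auto)
    qed auto
    moreover have "(p - v) \<bullet> (u - p) = - ((v - p) \<bullet> (u - p))"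
      by (simp add: inner_diff_left)
    ultimately show ?thesis using \<alpha> real by simp
  qed (use assms(2) in \<open>auto simp: proper_fun_def\<close>)
  then show ?thesis using \<alpha> by (simp add: convex_subgradient_def)
qed

text \<open>The mean value inequality for \<open>\<Phi>\<close> minus its linear part at \<open>w\<close>. This simple argument
  gives the constant \<open>L\<close> in place of the sharp \<open>L / 2\<close>.\<close>

lemma lipschitz_gradient_quadratic_bound:
  assumes grad: "\<And>u. GDERIV \<Phi> u :> G u" and lip: "\<And>u v. norm (G u - G v) \<le> L * norm (u - v)"
    and "L \<ge> 0"
  shows "\<bar>\<Phi> u - \<Phi> w - G w \<bullet> (u - w)\<bar> \<le> L * (norm (u - w))\<^sup>2"
proof -
  have "norm ((\<Phi> u - G w \<bullet> u) - (\<Phi> w - G w \<bullet> w)) \<le> (L * norm (u - w)) * norm (u - w)"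
  proof (rule differentiable_bound[where f = "\<lambda>z. \<Phi> z - G w \<bullet> z" and x = u and y = w
        and f' = "\<lambda>z h. h \<bullet> G z - G w \<bullet> h" and S = "cball w (norm (u - w))"])
    fix z assume z: "z \<in> cball w (norm (u - w))"
    show "((\<lambda>z. \<Phi> z - G w \<bullet> z) has_derivative (\<lambda>h. h \<bullet> G z - G w \<bullet> h)) (at z within cball w (norm (u - w)))"
      using grad[of z] unfolding gderiv_def
      by (intro has_derivative_at_withinI[OF has_derivative_diff]
          has_derivative_inner_right has_derivative_ident)
    have "norm (h \<bullet> G z - G w \<bullet> h) \<le> (L * norm (u - w)) * norm h" for h
    proof -
      have "norm (h \<bullet> G z - G w \<bullet> h) = \<bar>(G z - G w) \<bullet> h\<bar>"
        by (simp add: inner_diff_left inner_commute[of h])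
      also have "\<dots> \<le> norm (G z - G w) * norm h" by (rule Cauchy_Schwarz_ineq2)
      also have "norm (G z - G w) \<le> L * norm (z - w)" by (rule lip)
      also have "\<dots> \<le> L * norm (u - w)"
        using z \<open>L \<ge> 0\<close> by (intro mult_left_mono) (auto simp: dist_norm norm_minus_commute)
      finally show ?thesis by (simp add: mult_right_mono)
    qed
    then show "onorm (\<lambda>h. h \<bullet> G z - G w \<bullet> h) \<le> L * norm (u - w)"
      using \<open>L \<ge> 0\<close> by (intro onorm_bound) auto
  qed (auto simp: dist_norm norm_minus_commute)
  moreover have "(\<Phi> u - G w \<bullet> u) - (\<Phi> w - G w \<bullet> w) = \<Phi> u - \<Phi> w - G w \<bullet> (u - w)"
    by (simp add: inner_diff_right)
  ultimately show ?thesis by (simp add: power2_eq_square mult.assoc)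
qed

text \<open>Proximal subgradients are Frechet subgradients. All elements of Frechet subdifferentials needed here
  arise in this way.\<close>

lemma quadratic_minorant_imp_frechet_subdiff:
  assumes fin: "\<bar>g z\<bar> \<noteq> \<infinity>"
    and minor: "\<And>y. g z + ereal (v \<bullet> (y - z) - K * (norm (y - z))\<^sup>2) \<le> g y"
  shows "v \<in> frechet_subdiff g z"
proof -
  have "0 \<le> Liminf (at z) (\<lambda>y. (g y - g z - ereal (v \<bullet> (y - z))) / ereal (norm (y - z)))"
  proof -
    have "((\<lambda>y. ereal (- K * norm (y - z))) \<longlongrightarrow> ereal (- K * norm (z - z))) (at z)"
      by (intro tendsto_intros)
    then have lim: "((\<lambda>y. ereal (- K * norm (y - z))) \<longlongrightarrow> 0) (at z)" by (simp add: zero_ereal_def)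
    have "Liminf (at z) (\<lambda>y. ereal (- K * norm (y - z)))
        \<le> Liminf (at z) (\<lambda>y. (g y - g z - ereal (v \<bullet> (y - z))) / ereal (norm (y - z)))"
    proof (rule Liminf_mono)
      have "\<forall>\<^sub>F y in at z. y \<noteq> z" by (simp add: eventually_at_filter)
      then show "\<forall>\<^sub>F y in at z. ereal (- K * norm (y - z))
          \<le> (g y - g z - ereal (v \<bullet> (y - z))) / ereal (norm (y - z))"
      proof eventually_elim
        case (elim y)
        then have pos: "norm (y - z) > 0" by simp
        show ?case
        proof (cases "g y")
          case (real r)
          obtain s where s: "g z = ereal s" using fin by auto
          have "s + (v \<bullet> (y - z) - K * (norm (y - z))\<^sup>2) \<le> r" using minor[of y] real s by simp
          then have "- K * norm (y - z) * norm (y - z) \<le> r - s - v \<bullet> (y - z)"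
            by (simp add: power2_eq_square mult.assoc)
          then show ?thesis using real s pos by (simp add: pos_le_divide_eq)
        next
          case PInf
          then show ?thesis using fin pos by auto
        next
          case MInf
          then show ?thesis using fin minor[of y] by auto
        qed
      qed
    qed
    moreover have "Liminf (at z) (\<lambda>y. ereal (- K * norm (y - z))) = 0 \<or> at z = bot"
      using lim lim_imp_Liminf by blast
    ultimately show ?thesis by (auto simp: Liminf_bot)
  qed
  then show ?thesis using fin by (auto simp: frechet_subdiff_def)
qed

lemma frechet_subdiff_imp_limiting_subdiff:
  assumes "v \<in> frechet_subdiff g z"
  shows "v \<in> limiting_subdiff g z"
  unfolding limiting_subdiff_def mem_Collect_eq
proof (intro conjI exI)
  show "g z < \<infinity>" using assms by (simp add: frechet_subdiff_def)
  show "\<forall>k. (\<lambda>_. v) k \<in> frechet_subdiff g ((\<lambda>_. z) k)" using assms by simp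
qed auto

section \<open>The proximal map and the subgradients of the Lyapunov function\<close>

text \<open>What has to be shown is that the minimum defining the proximal point is attained. Coercivity comes
  from the lower bound on \<open>f + \<Phi>\<close>: since \<open>\<Phi>\<close> grows at most like \<open>L * (norm (u - v))\<^sup>2\<close>, it gives a lower bound for
  \<open>f\<close> that the term \<open>(norm (u - v))\<^sup>2 / (2 * \<gamma>)\<close> dominates if \<open>2 * \<gamma> * L < 1\<close>.\<close>

lemma prox_subgradient:
  fixes f :: "'a::euclidean_space \<Rightarrow> ereal"
  assumes \<gamma>: "\<gamma> > 0" and f: "proper_fun f" "convex_fun f" "lsc_fun f"
    and grad: "\<And>u. GDERIV \<Phi> u :> G u" and lip: "\<And>u v. norm (G u - G v) \<le> L * norm (u - v)"
    and "L \<ge> 0" and m: "\<And>u. ereal m \<le> f u + ereal (\<Phi> u)" and small: "2 * \<gamma> * L < 1"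
  shows "convex_subgradient f (prox \<gamma> f v) ((1 / \<gamma>) *\<^sub>R (v - prox \<gamma> f v))"
proof -
  define g where "g = (\<lambda>u. f u + ereal (1 / (2 * \<gamma>) * (norm (u - v))\<^sup>2))"
  have "lsc_fun g" unfolding g_def
    by (intro lsc_fun_add_continuous f continuous_intros)
  obtain u\<^sub>0 where "f u\<^sub>0 < \<infinity>" using f(1) by (auto simp: proper_fun_def)
  then obtain c where c: "g u\<^sub>0 = ereal c"
    using f(1) by (cases "f u\<^sub>0") (auto simp: proper_fun_def g_def)
  define k where "k = 1 / (2 * \<gamma>) - L"
  have "k > 0" using small \<gamma> by (simp add: k_def field_simps)
  define D where "D = c - m + \<Phi> v"
  define A where "A = \<bar>D\<bar> + norm (G v)"
  have "norm u \<le> norm v + 1 + A / k" if "g u \<le> g u\<^sub>0" for u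
  proof -
    define r where "r = norm (u - v)"
    have "r \<ge> 0" by (simp add: r_def)
    have gc: "g u \<le> ereal c" using that c by simp
    then obtain \<beta> where \<beta>: "f u = ereal \<beta>"
      using m[of u] by (cases "f u") (auto simp: g_def)
    have 1: "\<beta> + 1 / (2 * \<gamma>) * r\<^sup>2 \<le> c" using gc \<beta> by (simp add: g_def r_def)
    have 2: "m \<le> \<beta> + \<Phi> u" using m[of u] \<beta> by simp
    have "\<Phi> u - \<Phi> v - G v \<bullet> (u - v) \<le> L * r\<^sup>2"
      using lipschitz_gradient_quadratic_bound[OF grad lip \<open>L \<ge> 0\<close>, of u v] by (simp add: r_def)
    moreover have "G v \<bullet> (u - v) \<le> norm (G v) * r"
      unfolding r_def by (rule norm_cauchy_schwarz)
    moreover have "k * r\<^sup>2 = 1 / (2 * \<gamma>) * r\<^sup>2 - L * r\<^sup>2" by (simp add: k_def left_diff_distrib)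
    ultimately have le: "k * r\<^sup>2 \<le> D + norm (G v) * r" using 1 2 by (simp add: D_def)
    have "r \<le> 1 + A / k"
    proof (cases "r \<le> 1")
      case True
      then show ?thesis using \<open>k > 0\<close> by (simp add: A_def add_increasing2)
    next
      case False
      have "D \<le> \<bar>D\<bar> * r" using False mult_left_mono[of 1 r "\<bar>D\<bar>"] by simp
      then have "k * r * r \<le> A * r"
        using le by (simp add: A_def distrib_right power2_eq_square mult.assoc)
      then have "k * r \<le> A" using False by simp
      then have "r \<le> A / k" using \<open>k > 0\<close> by (simp add: field_simps)
      then show ?thesis by simp
    qed
    moreover have "norm u \<le> norm v + r"
      unfolding r_def using norm_triangle_sub[of u v] .
    ultimately show ?thesis by simp
  qed
  then obtain p where "\<And>u. g p \<le> g u" using lsc_fun_attains_min[OF \<open>lsc_fun g\<close>] by metis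
  then have "is_arg_min g (\<lambda>_. True) p" by (auto simp: is_arg_min_linorder)
  then have "is_arg_min g (\<lambda>_. True) (prox \<gamma> f v)"
    unfolding prox_def g_def[symmetric] arg_min_def by (rule someI)
  then show ?thesis
    by (intro proximal_minimizer_subgradient[OF \<gamma> f(1,2)]) (auto simp: is_arg_min_linorder g_def)
qed

lemma proximal_nonexpansive:
  assumes "\<gamma> > 0" "convex_subgradient f p ((1 / \<gamma>) *\<^sub>R (v - p))"
    "convex_subgradient f q ((1 / \<gamma>) *\<^sub>R (w - q))"
  shows "norm (p - q) \<le> norm (v - w)"
proof -
  have "(1 / \<gamma>) *\<^sub>R (v - p) - (1 / \<gamma>) *\<^sub>R (w - q) = (1 / \<gamma>) *\<^sub>R ((v - w) - (p - q))"
    by (simp add: algebra_simps)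
  then have "0 \<le> (1 / \<gamma>) * (((v - w) - (p - q)) \<bullet> (p - q))"
    using convex_subgradient_monotone[OF assms(2,3)] by (simp only: inner_scaleR_left)
  then have "0 \<le> ((v - w) - (p - q)) \<bullet> (p - q)"
    using assms(1) by (simp add: zero_le_divide_iff)
  then have "(p - q) \<bullet> (p - q) \<le> (v - w) \<bullet> (p - q)" by (simp add: inner_diff_left)
  also have "\<dots> \<le> norm (v - w) * norm (p - q)" by (rule norm_cauchy_schwarz)
  finally have "norm (p - q) * norm (p - q) \<le> norm (v - w) * norm (p - q)"
    by (simp add: power2_norm_eq_inner[symmetric] power2_eq_square)
  then show ?thesis by (cases "p = q") auto
qed

lemma norm_sq_minorant:
  fixes p q :: "'a::real_inner"
  shows "(norm p)\<^sup>2 + 2 * (p \<bullet> (q - p)) \<le> (norm q)\<^sup>2"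
proof -
  have "0 \<le> (q - p) \<bullet> (q - p)" by simp
  then show ?thesis
    by (simp add: power2_norm_eq_inner inner_diff_left inner_diff_right inner_commute[of q p])
qed

text \<open>The subgradient of \<open>f\<close> plus the gradients of the smooth terms. The two squares are convex, hence above
  their tangents, so that only \<open>\<Phi>\<close> contributes a quadratic error.\<close>

lemma H_fun_frechet_subdiff:
  fixes f :: "'a::euclidean_space \<Rightarrow> ereal"
  assumes pos: "a > 0" "\<gamma> > 0" "L \<ge> 0"
    and grad: "\<And>u. GDERIV \<Phi> u :> G u" and lip: "\<And>u v. norm (G u - G v) \<le> L * norm (u - v)"
    and sub: "convex_subgradient f u \<xi>"
  shows "(\<xi> + G u + (1 / \<gamma>) *\<^sub>R (u - v),
      (1 / \<gamma>) *\<^sub>R (a *\<^sub>R v + b *\<^sub>R w) - (1 / \<gamma>) *\<^sub>R (u - v),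
      (b / (\<gamma> * a)) *\<^sub>R (a *\<^sub>R v + b *\<^sub>R w)) \<in> frechet_subdiff (H_fun a b \<gamma> f \<Phi>) (u, v, w)"
    (is "?\<zeta> \<in> _")
proof (rule quadratic_minorant_imp_frechet_subdiff[where K = L])
  obtain \<alpha> where \<alpha>: "f u = ereal \<alpha>" using sub by (auto simp: convex_subgradient_def)
  then show "\<bar>H_fun a b \<gamma> f \<Phi> (u, v, w)\<bar> \<noteq> \<infinity>" by (simp add: H_fun_def)
  fix z :: "'a \<times> 'a \<times> 'a"
  obtain u' v' w' where z: "z = (u', v', w')" by (cases z)
  define q where "q = a *\<^sub>R v + b *\<^sub>R w"
  define q' where "q' = a *\<^sub>R v' + b *\<^sub>R w'"
  have "\<alpha> + \<xi> \<bullet> (u' - u) \<le> \<beta>" if "f u' = ereal \<beta>" for \<beta>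
    using sub \<alpha> that by (auto simp: convex_subgradient_def dest: spec[of _ u'])
  moreover have "\<Phi> u + G u \<bullet> (u' - u) - L * (norm (z - (u, v, w)))\<^sup>2 \<le> \<Phi> u'"
  proof -
    have "\<Phi> u + G u \<bullet> (u' - u) - L * (norm (u' - u))\<^sup>2 \<le> \<Phi> u'"
      using lipschitz_gradient_quadratic_bound[OF grad lip pos(3), of u' u] by linarith
    moreover have "norm (u' - u) \<le> norm (z - (u, v, w))"
      using norm_fst_le[of "u' - u" "(v' - v, w' - w)"] by (simp add: z)
    then have "L * (norm (u' - u))\<^sup>2 \<le> L * (norm (z - (u, v, w)))\<^sup>2"
      using pos(3) by (intro mult_left_mono power_mono) auto
    ultimately show ?thesis by linarith
  qed
  moreover have "1 / (2 * \<gamma>) * (norm (u - v))\<^sup>2 + (1 / \<gamma>) * ((u - v) \<bullet> ((u' - v') - (u - v)))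
      \<le> 1 / (2 * \<gamma>) * (norm (u' - v'))\<^sup>2"
    using mult_left_mono[OF norm_sq_minorant[of "u - v" "u' - v'"], of "1 / (2 * \<gamma>)"] pos
    by (simp add: distrib_left)
  moreover have "1 / (2 * \<gamma> * a) * (norm q)\<^sup>2 + (1 / (\<gamma> * a)) * (q \<bullet> (q' - q))
      \<le> 1 / (2 * \<gamma> * a) * (norm q')\<^sup>2"
    using mult_left_mono[OF norm_sq_minorant[of q q'], of "1 / (2 * \<gamma> * a)"] pos
    by (simp add: distrib_left)
  moreover have "?\<zeta> \<bullet> (z - (u, v, w)) = \<xi> \<bullet> (u' - u) + G u \<bullet> (u' - u)
      + (1 / \<gamma>) * ((u - v) \<bullet> ((u' - v') - (u - v))) + (1 / (\<gamma> * a)) * (q \<bullet> (q' - q))"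
  proof -
    have "?\<zeta> \<bullet> (z - (u, v, w)) = (\<xi> + G u + (1 / \<gamma>) *\<^sub>R (u - v)) \<bullet> (u' - u)
        + ((1 / \<gamma>) *\<^sub>R q - (1 / \<gamma>) *\<^sub>R (u - v)) \<bullet> (v' - v) + ((b / (\<gamma> * a)) *\<^sub>R q) \<bullet> (w' - w)"
      by (simp add: z q_def)
    also have "\<dots> = \<xi> \<bullet> (u' - u) + G u \<bullet> (u' - u) + (1 / \<gamma>) * ((u - v) \<bullet> ((u' - u) - (v' - v)))
        + ((1 / \<gamma>) * (q \<bullet> (v' - v)) + (b / (\<gamma> * a)) * (q \<bullet> (w' - w)))"
      by (simp only: inner_add_left inner_diff_left inner_diff_right inner_scaleR_left
          right_diff_distrib)
    also have "(1 / \<gamma>) * (q \<bullet> (v' - v)) + (b / (\<gamma> * a)) * (q \<bullet> (w' - w)) = (1 / (\<gamma> * a)) * (q \<bullet> (q' - q))"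
    proof -
      have "q' - q = a *\<^sub>R (v' - v) + b *\<^sub>R (w' - w)" by (simp add: q_def q'_def algebra_simps)
      then have "q \<bullet> (q' - q) = a * (q \<bullet> (v' - v)) + b * (q \<bullet> (w' - w))"
        by (simp only: inner_add_right inner_scaleR_right)
      then show ?thesis using pos by (simp add: field_simps)
    qed
    also have "(u' - u) - (v' - v) = (u' - v') - (u - v)" by simp
    finally show ?thesis .
  qed
  ultimately show "H_fun a b \<gamma> f \<Phi> (u, v, w)
      + ereal (?\<zeta> \<bullet> (z - (u, v, w)) - L * (norm (z - (u, v, w)))\<^sup>2) \<le> H_fun a b \<gamma> f \<Phi> z"
    using \<alpha> sub unfolding convex_subgradient_def
    by (cases "f u'") (auto simp: H_fun_def z q_def[symmetric] q'_def[symmetric] dest: spec[of _ u'])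
qed

section \<open>Dissipation of energy along the flow\<close>

text \<open>The dynamical system. The name \<open>X\<close> stands for the pair \<open>(x, y)\<close>, \<open>p\<close> for the proximal point,
  \<open>\<xi>\<close> for the subgradient of \<open>f\<close> at \<open>p\<close> that the proximal step provides, and \<open>E\<close> for the energy, which is the
  value of \<open>H\<close> at \<open>(p, x, y)\<close>.\<close>

locale prox_gradient_flow =
  fixes a b \<gamma> L m :: real
    and f :: "'a::euclidean_space \<Rightarrow> ereal" and \<Phi> :: "'a \<Rightarrow> real" and G :: "'a \<Rightarrow> 'a"
    and x x' y y' :: "real \<Rightarrow> 'a"
  assumes pos: "a > 0" "b > 0" "\<gamma> > 0" "L > 0"
    and f: "proper_fun f" "convex_fun f" "lsc_fun f"
    and grad: "GDERIV \<Phi> u :> G u"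
    and lip: "norm (G u - G v) \<le> L * norm (u - v)"
    and bounded_below: "ereal m \<le> f u + ereal (\<Phi> u)"
    and param1: "2 * \<gamma> * L * (\<bar>1 - a\<bar> + \<gamma> * L) + \<bar>1 - a\<bar> + \<gamma> * L + b * \<gamma> * L < 1"
    and param2: "a * b + a / 2 + 1 / 2 * a * \<bar>1 - a\<bar> + 1 / 2 * \<gamma> * a * L + 1 / 2 * \<gamma> * a * b * L < b"
    and x_deriv: "t \<ge> 0 \<Longrightarrow> (x has_vector_derivative x' t) (at t within {0..})"
    and y_deriv: "t \<ge> 0 \<Longrightarrow> (y has_vector_derivative y' t) (at t within {0..})"
    and prox_eq: "t \<ge> 0 \<Longrightarrow>
      x' t + x t = prox \<gamma> f (x t - \<gamma> *\<^sub>R G (x t) - a *\<^sub>R x t - b *\<^sub>R y t)"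
    and y_eq: "t \<ge> 0 \<Longrightarrow> y' t + a *\<^sub>R x t + b *\<^sub>R y t = 0"
begin

definition p :: "real \<Rightarrow> 'a" where "p t = x t + x' t"

definition \<xi> :: "real \<Rightarrow> 'a" where "\<xi> t = (1 / \<gamma>) *\<^sub>R (y' t - x' t) - G (x t)"

text \<open>\<open>\<alpha>\<close> bounds the Lipschitz constant of the argument of the proximal map in \<open>x\<close>; the constant in
  \<open>y\<close> is \<open>b\<close>.\<close>

definition \<alpha> :: real where "\<alpha> = \<bar>1 - a\<bar> + \<gamma> * L"

definition E :: "real \<Rightarrow> real" where
  "E t = real_of_ereal (f (p t)) + \<Phi> (p t) + 1 / (2 * \<gamma>) * (norm (x' t))\<^sup>2
    + 1 / (2 * \<gamma> * a) * (norm (y' t))\<^sup>2"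

text \<open>The rate of dissipation: up to normalization the two entries are the slacks in the two conditions
  on the parameters.\<close>

definition c :: real where
  "c = min ((1 - (2 * \<gamma> * L * \<alpha> + \<alpha> + b * \<gamma> * L)) / (2 * \<gamma>))
    ((b - (a * b + a / 2 + 1 / 2 * a * \<alpha> + 1 / 2 * \<gamma> * a * b * L)) / (\<gamma> * a))"

definition X :: "real \<Rightarrow> 'a \<times> 'a" where "X t = (x t, y t)"

definition X' :: "real \<Rightarrow> 'a \<times> 'a" where "X' t = (x' t, y' t)"

lemma \<alpha>_nonneg: "\<alpha> \<ge> 0" using pos by (simp add: \<alpha>_def)

lemma y'_eq: "t \<ge> 0 \<Longrightarrow> y' t = - (a *\<^sub>R x t + b *\<^sub>R y t)"
  using y_eq[of t] by (simp only: add.assoc eq_neg_iff_add_eq_0)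

text \<open>For \<open>q = \<gamma> * L\<close> the first parameter condition contains \<open>2 * q\<^sup>2 + q < 1\<close>, that is,
  \<open>(2 * q - 1) * (q + 1) < 0\<close>.\<close>

lemma step_small: "2 * \<gamma> * L < 1"
proof (rule ccontr)
  define q where "q = \<gamma> * L"
  assume "\<not> 2 * \<gamma> * L < 1"
  then have q: "q \<ge> 1 / 2" by (simp add: q_def)
  have "2 * q * \<bar>1 - a\<bar> + 2 * q * q + \<bar>1 - a\<bar> + q + b * q < 1"
    using param1 by (simp add: q_def algebra_simps)
  moreover have "2 * q * q \<ge> q" using q mult_right_mono[of 1 "2 * q" q] by simp
  moreover have "2 * q * \<bar>1 - a\<bar> \<ge> 0" "b * q \<ge> 0" using q pos by auto
  ultimately show False using q by linarith
qed

lemma subgradient_along: "t \<ge> 0 \<Longrightarrow> convex_subgradient f (p t) (\<xi> t)"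
  and subgradient_residual: "t \<ge> 0 \<Longrightarrow>
    \<xi> t = (1 / \<gamma>) *\<^sub>R ((x t - \<gamma> *\<^sub>R G (x t) - a *\<^sub>R x t - b *\<^sub>R y t) - p t)"
proof -
  assume t: "t \<ge> 0"
  have "(1 / \<gamma>) *\<^sub>R ((x t - \<gamma> *\<^sub>R G (x t) - a *\<^sub>R x t - b *\<^sub>R y t) - p t)
      = (1 / \<gamma>) *\<^sub>R ((y' t - x' t) - \<gamma> *\<^sub>R G (x t))"
    by (simp add: p_def y'_eq[OF t])
  also have "\<dots> = \<xi> t" using pos by (simp add: \<xi>_def scaleR_diff_right)
  finally show eq: "\<xi> t = (1 / \<gamma>) *\<^sub>R ((x t - \<gamma> *\<^sub>R G (x t) - a *\<^sub>R x t - b *\<^sub>R y t) - p t)" ..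
  have "p t = prox \<gamma> f (x t - \<gamma> *\<^sub>R G (x t) - a *\<^sub>R x t - b *\<^sub>R y t)"
    using prox_eq[OF t] by (simp add: p_def add.commute)
  then show "convex_subgradient f (p t) (\<xi> t)"
    using prox_subgradient[OF pos(3) f grad lip _ bounded_below step_small,
        of "x t - \<gamma> *\<^sub>R G (x t) - a *\<^sub>R x t - b *\<^sub>R y t"] pos eq by simp
qed

lemma p_increment:
  assumes "s \<ge> 0" "t \<ge> 0"
  shows "norm (p s - p t) \<le> \<alpha> * norm (x s - x t) + b * norm (y s - y t)"
proof -
  define v where "v = (\<lambda>t. x t - \<gamma> *\<^sub>R G (x t) - a *\<^sub>R x t - b *\<^sub>R y t)"
  have "convex_subgradient f (p t) ((1 / \<gamma>) *\<^sub>R (v t - p t))" if "t \<ge> 0" for t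
    using subgradient_along[OF that] subgradient_residual[OF that] by (simp add: v_def)
  then have "norm (p s - p t) \<le> norm (v s - v t)"
    using assms pos by (intro proximal_nonexpansive[of \<gamma> f]) auto
  also have "v s - v t = (1 - a) *\<^sub>R (x s - x t) - \<gamma> *\<^sub>R (G (x s) - G (x t)) - b *\<^sub>R (y s - y t)"
    by (simp add: v_def algebra_simps)
  also have "norm \<dots> \<le> norm ((1 - a) *\<^sub>R (x s - x t)) + norm (\<gamma> *\<^sub>R (G (x s) - G (x t)))
      + norm (b *\<^sub>R (y s - y t))"
    by (meson norm_triangle_ineq4 order_trans add_right_mono)
  also have "\<dots> \<le> \<bar>1 - a\<bar> * norm (x s - x t) + \<gamma> * (L * norm (x s - x t)) + b * norm (y s - y t)"
    using pos lip[of "x s" "x t"] by simp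
  also have "\<dots> = \<alpha> * norm (x s - x t) + b * norm (y s - y t)"
    by (simp add: \<alpha>_def distrib_right)
  finally show ?thesis .
qed

lemma continuous_x: "continuous_on {0..} x"
  and continuous_y: "continuous_on {0..} y"
  using x_deriv y_deriv by (auto intro: continuous_on_vector_derivative)

lemma continuous_G: "continuous_on UNIV G"
proof (rule lipschitz_on_continuous_on)
  show "L-lipschitz_on UNIV G" using lip pos by (intro lipschitz_onI) (auto simp: dist_norm)
qed

lemma continuous_Phi: "continuous_on UNIV \<Phi>"
  using grad unfolding gderiv_def
  by (intro continuous_at_imp_continuous_on ballI has_derivative_continuous)

lemma continuous_p: "continuous_on {0..} p"
  unfolding continuous_on_def
proof
  fix t :: real assume t: "t \<in> {0..}"
  have "((\<lambda>s. \<alpha> * norm (x s - x t) + b * norm (y s - y t)) \<longlongrightarrow>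
      \<alpha> * norm (x t - x t) + b * norm (y t - y t)) (at t within {0..})"
    using t continuous_x continuous_y by (intro tendsto_intros) (auto simp: continuous_on_def)
  then have "((\<lambda>s. \<alpha> * norm (x s - x t) + b * norm (y s - y t)) \<longlongrightarrow> 0) (at t within {0..})"
    by simp
  then have "((\<lambda>s. p s - p t) \<longlongrightarrow> 0) (at t within {0..})"
    by (rule Lim_null_comparison[rotated]) (use t p_increment in \<open>auto simp: eventually_at_filter\<close>)
  then show "(p \<longlongrightarrow> p t) (at t within {0..})" by (rule LIM_zero_cancel)
qed

lemma continuous_x': "continuous_on {0..} x'"
proof -
  have "continuous_on {0..} (\<lambda>t. p t - x t)" by (intro continuous_intros continuous_p continuous_x)
  then show ?thesis by (simp add: p_def)
qed

lemma continuous_y': "continuous_on {0..} y'"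
proof -
  have "continuous_on {0..} (\<lambda>t. - (a *\<^sub>R x t + b *\<^sub>R y t))"
    by (intro continuous_intros continuous_x continuous_y)
  then show ?thesis by (rule continuous_on_eq) (simp add: y'_eq)
qed

lemma continuous_\<xi>: "continuous_on {0..} \<xi>"
  unfolding \<xi>_def
  by (intro continuous_intros continuous_x' continuous_y' continuous_x
      continuous_on_compose2[OF continuous_G]) auto

text \<open>Although \<open>f\<close> need not be continuous, it is so along the curve: the subgradient inequalities at both
  end points squeeze the increment between two quantities of the size of \<open>p s - p t\<close>.\<close>

lemma continuous_f_along: "continuous_on {0..} (\<lambda>t. real_of_ereal (f (p t)))"
  unfolding continuous_on_def
proof
  fix t :: real assume t: "t \<in> {0..}"
  have "((\<lambda>s. \<xi> t \<bullet> (p s - p t)) \<longlongrightarrow> \<xi> t \<bullet> (p t - p t)) (at t within {0..})"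
    "((\<lambda>s. \<xi> s \<bullet> (p s - p t)) \<longlongrightarrow> \<xi> t \<bullet> (p t - p t)) (at t within {0..})"
    using t continuous_p continuous_\<xi> by (intro tendsto_intros; auto simp: continuous_on_def)+
  then have lims: "((\<lambda>s. \<xi> t \<bullet> (p s - p t)) \<longlongrightarrow> 0) (at t within {0..})"
    "((\<lambda>s. \<xi> s \<bullet> (p s - p t)) \<longlongrightarrow> 0) (at t within {0..})" by simp_all
  have bounds: "\<xi> t \<bullet> (p s - p t) \<le> real_of_ereal (f (p s)) - real_of_ereal (f (p t))"
    "real_of_ereal (f (p s)) - real_of_ereal (f (p t)) \<le> \<xi> s \<bullet> (p s - p t)" if "s \<ge> 0" for s
    using convex_subgradient_le[OF subgradient_along subgradient_along, of t s]
      convex_subgradient_le[OF subgradient_along subgradient_along, of s t] t that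
    by (simp_all add: inner_diff_right)
  have "((\<lambda>s. real_of_ereal (f (p s)) - real_of_ereal (f (p t))) \<longlongrightarrow> 0) (at t within {0..})"
    by (rule tendsto_sandwich[OF _ _ lims]) (use bounds in \<open>auto simp: eventually_at_filter\<close>)
  then show "((\<lambda>s. real_of_ereal (f (p s))) \<longlongrightarrow> real_of_ereal (f (p t))) (at t within {0..})"
    by (rule LIM_zero_cancel)
qed

lemma continuous_E: "continuous_on {0..} E"
  unfolding E_def
  by (intro continuous_intros continuous_f_along continuous_x' continuous_y'
      continuous_on_compose2[OF continuous_Phi continuous_p]) auto

lemma c_pos: "c > 0"
proof -
  have "2 * \<gamma> * L * \<alpha> + \<alpha> + b * \<gamma> * L < 1" using param1 by (simp add: \<alpha>_def)
  moreover have "a * b + a / 2 + 1 / 2 * a * \<alpha> + 1 / 2 * \<gamma> * a * b * L < b"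
    using param2 by (simp add: \<alpha>_def algebra_simps)
  ultimately show ?thesis using pos by (simp add: c_def)
qed

text \<open>A quadratic form in the speeds \<open>A\<close> of \<open>x\<close> and \<open>B\<close> of \<open>y\<close>. Its mixed term is estimated by
  \<open>2 * A * B \<le> A\<^sup>2 + B\<^sup>2\<close>, and the remaining coefficients are negative by the parameter conditions.\<close>

lemma dissipation_inequality:
  fixes A B :: real
  assumes "A \<ge> 0" "B \<ge> 0"
  shows "(1 / \<gamma> * B + L * A) * (\<alpha> * A + b * B) - 1 / \<gamma> * A\<^sup>2 + 1 / \<gamma> * (A * B) - b / (\<gamma> * a) * B\<^sup>2
    \<le> - c * (A\<^sup>2 + B\<^sup>2)"
proof -
  define c1 where "c1 = (1 - (2 * \<gamma> * L * \<alpha> + \<alpha> + b * \<gamma> * L)) / (2 * \<gamma>)"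
  define c2 where "c2 = (b - (a * b + a / 2 + 1 / 2 * a * \<alpha> + 1 / 2 * \<gamma> * a * b * L)) / (\<gamma> * a)"
  define w where "w = (\<alpha> + \<gamma> * L * b + 1) / \<gamma>"
  have "w \<ge> 0" using pos \<alpha>_nonneg by (simp add: w_def)
  have "c \<le> c1" "c \<le> c2" by (simp_all add: c_def c1_def c2_def)
  then have "c * A\<^sup>2 \<le> c1 * A\<^sup>2" "c * B\<^sup>2 \<le> c2 * B\<^sup>2" by (auto intro: mult_right_mono)
  moreover have "(1 / \<gamma> * B + L * A) * (\<alpha> * A + b * B) - 1 / \<gamma> * A\<^sup>2 + 1 / \<gamma> * (A * B) - b / (\<gamma> * a) * B\<^sup>2
      = - c1 * A\<^sup>2 - c2 * B\<^sup>2 - w / 2 * (A - B)\<^sup>2"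
    using pos by (simp add: c1_def c2_def w_def field_simps power2_eq_square)
  moreover have "w / 2 * (A - B)\<^sup>2 \<ge> 0" using \<open>w \<ge> 0\<close> by simp
  ultimately show ?thesis by (simp add: distrib_left)
qed

text \<open>The function \<open>p\<close> is merely Lipschitz, so the energy has no derivative in general. Its increment is
  therefore estimated with \<open>p s - p t\<close> left as it is; the increment of \<open>x'\<close> is that of \<open>p\<close> minus that
  of \<open>x\<close>. All terms with \<open>p s - p t\<close> are collected into one inner product, to which nonexpansiveness of
  the proximal map is applied, and the right-hand side has a limit as \<open>s \<rightarrow> t\<close> after division by
  \<open>s - t\<close>.\<close>

lemma energy_increment:
  assumes "0 \<le> t" "t < s"
  defines "dx \<equiv> (1 / (s - t)) *\<^sub>R (x s - x t)" and "dy \<equiv> (1 / (s - t)) *\<^sub>R (y s - y t)"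
  shows "E s - E t \<le> (norm (\<xi> s + G (p t) + (1 / (2 * \<gamma>)) *\<^sub>R (x' s + x' t)) * (\<alpha> * norm dx + b * norm dy)
    + L * norm (p s - p t) * (\<alpha> * norm dx + b * norm dy)
    - 1 / (2 * \<gamma>) * ((x' s + x' t) \<bullet> dx)
    - 1 / (2 * \<gamma> * a) * ((y' s + y' t) \<bullet> (a *\<^sub>R dx + b *\<^sub>R dy))) * (s - t)"
proof -
  define \<Delta> where "\<Delta> = p s - p t"
  define B where "B = \<alpha> * norm dx + b * norm dy"
  have s: "s \<ge> 0" "s - t > 0" using assms by auto
  have dx: "x s - x t = (s - t) *\<^sub>R dx" and dy: "y s - y t = (s - t) *\<^sub>R dy"
    using s by (simp_all add: dx_def dy_def)
  have "norm \<Delta> \<le> \<alpha> * norm (x s - x t) + b * norm (y s - y t)"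
    unfolding \<Delta>_def by (rule p_increment[OF s(1) assms(1)])
  also have "\<dots> = B * (s - t)" using s by (simp add: dx dy B_def distrib_left mult_ac)
  finally have \<Delta>_le: "norm \<Delta> \<le> B * (s - t)" .
  have 1: "real_of_ereal (f (p s)) - real_of_ereal (f (p t)) \<le> \<xi> s \<bullet> \<Delta>"
    using convex_subgradient_le[OF subgradient_along[OF s(1)] subgradient_along[OF assms(1)]]
    by (simp add: \<Delta>_def inner_diff_right)
  have 2: "\<Phi> (p s) - \<Phi> (p t) \<le> G (p t) \<bullet> \<Delta> + L * (norm \<Delta>)\<^sup>2"
    using lipschitz_gradient_quadratic_bound[OF grad lip, of "p s" "p t"] pos by (simp add: \<Delta>_def)
  have diff_sq: "(norm u)\<^sup>2 - (norm v)\<^sup>2 = (u + v) \<bullet> (u - v)" for u v :: 'a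
    by (simp add: power2_norm_eq_inner inner_add_left inner_diff_right inner_commute[of v u])
  have "x' s - x' t = \<Delta> - (s - t) *\<^sub>R dx"
    unfolding dx[symmetric] by (simp add: \<Delta>_def p_def)
  then have 3: "(norm (x' s))\<^sup>2 - (norm (x' t))\<^sup>2
      = (x' s + x' t) \<bullet> \<Delta> - (s - t) * ((x' s + x' t) \<bullet> dx)"
    by (simp add: diff_sq inner_diff_right)
  have "y' s - y' t = - (a *\<^sub>R (x s - x t) + b *\<^sub>R (y s - y t))"
    by (simp add: y'_eq s assms algebra_simps)
  also have "\<dots> = - (s - t) *\<^sub>R (a *\<^sub>R dx + b *\<^sub>R dy)" by (simp add: dx dy algebra_simps)
  finally have 4: "(norm (y' s))\<^sup>2 - (norm (y' t))\<^sup>2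
      = - (s - t) * ((y' s + y' t) \<bullet> (a *\<^sub>R dx + b *\<^sub>R dy))"
    by (simp only: diff_sq inner_scaleR_right)
  define Q where "Q = 1 / (2 * \<gamma>) * ((x' s + x' t) \<bullet> dx)
    + 1 / (2 * \<gamma> * a) * ((y' s + y' t) \<bullet> (a *\<^sub>R dx + b *\<^sub>R dy))"
  define \<zeta> where "\<zeta> = \<xi> s + G (p t) + (1 / (2 * \<gamma>)) *\<^sub>R (x' s + x' t)"
  have regroup: "k * (u - d * v) + l * (- d * w) = k * u - (k * v + l * w) * d"
    for k l u v w d :: real by (simp add: algebra_simps)
  have "E s - E t = (real_of_ereal (f (p s)) - real_of_ereal (f (p t))) + (\<Phi> (p s) - \<Phi> (p t))
      + 1 / (2 * \<gamma>) * ((norm (x' s))\<^sup>2 - (norm (x' t))\<^sup>2)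
      + 1 / (2 * \<gamma> * a) * ((norm (y' s))\<^sup>2 - (norm (y' t))\<^sup>2)"
    by (simp add: E_def right_diff_distrib diff_divide_distrib)
  also have "\<dots> = (real_of_ereal (f (p s)) - real_of_ereal (f (p t))) + (\<Phi> (p s) - \<Phi> (p t))
      + 1 / (2 * \<gamma>) * ((x' s + x' t) \<bullet> \<Delta>) - Q * (s - t)"
    unfolding 3 4 Q_def
    using regroup[of "1 / (2 * \<gamma>)" "(x' s + x' t) \<bullet> \<Delta>" "s - t" "(x' s + x' t) \<bullet> dx"
        "1 / (2 * \<gamma> * a)" "(y' s + y' t) \<bullet> (a *\<^sub>R dx + b *\<^sub>R dy)"]
    by linarith
  also have "\<dots> \<le> \<xi> s \<bullet> \<Delta> + (G (p t) \<bullet> \<Delta> + L * (norm \<Delta>)\<^sup>2) + 1 / (2 * \<gamma>) * ((x' s + x' t) \<bullet> \<Delta>) - Q * (s - t)"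
    using 1 2 by simp
  also have "\<dots> = \<zeta> \<bullet> \<Delta> + L * norm \<Delta> * norm \<Delta> - Q * (s - t)"
    by (simp add: \<zeta>_def inner_add_left power2_eq_square)
  also have "\<dots> \<le> norm \<zeta> * (B * (s - t)) + L * norm \<Delta> * (B * (s - t)) - Q * (s - t)"
  proof -
    have "\<zeta> \<bullet> \<Delta> \<le> norm \<zeta> * norm \<Delta>" by (rule norm_cauchy_schwarz)
    also have "\<dots> \<le> norm \<zeta> * (B * (s - t))" using \<Delta>_le by (intro mult_left_mono) auto
    finally have "\<zeta> \<bullet> \<Delta> \<le> norm \<zeta> * (B * (s - t))" .
    moreover have "L * norm \<Delta> * norm \<Delta> \<le> L * norm \<Delta> * (B * (s - t))"
      using \<Delta>_le pos by (intro mult_left_mono) auto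
    ultimately show ?thesis by linarith
  qed
  also have "\<dots> = (norm \<zeta> * B + L * norm \<Delta> * B - Q) * (s - t)" by (simp add: algebra_simps)
  finally show ?thesis unfolding \<zeta>_def B_def \<Delta>_def Q_def by (simp only: diff_diff_eq)
qed

lemma energy_dini:
  assumes t: "t \<ge> 0"
  shows "upper_dini_le E t (- c * (norm (X' t))\<^sup>2)"
proof -
  define dx where "dx = (\<lambda>s. (1 / (s - t)) *\<^sub>R (x s - x t))"
  define dy where "dy = (\<lambda>s. (1 / (s - t)) *\<^sub>R (y s - y t))"
  have lims: "(dx \<longlongrightarrow> x' t) (at_right t)" "(dy \<longlongrightarrow> y' t) (at_right t)"
    unfolding dx_def dy_def by (intro at_right_quotient x_deriv y_deriv t)+
  have rc: "(g \<longlongrightarrow> g t) (at_right t)" if "continuous_on {0..} g" for g :: "real \<Rightarrow> 'a"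
    using that t by (auto simp: continuous_on_def intro: tendsto_within_subset)
  define \<zeta> where "\<zeta> = \<xi> t + G (p t) + (1 / (2 * \<gamma>)) *\<^sub>R (x' t + x' t)"
  define R where "R = norm \<zeta> * (\<alpha> * norm (x' t) + b * norm (y' t))
    + L * norm (p t - p t) * (\<alpha> * norm (x' t) + b * norm (y' t))
    - 1 / (2 * \<gamma>) * ((x' t + x' t) \<bullet> x' t)
    - 1 / (2 * \<gamma> * a) * ((y' t + y' t) \<bullet> (a *\<^sub>R x' t + b *\<^sub>R y' t))"
  have "upper_dini_le E t R"
  proof (rule upper_dini_le_limit)
    show "\<forall>\<^sub>F s in at_right t. E s - E t \<le>
      (norm (\<xi> s + G (p t) + (1 / (2 * \<gamma>)) *\<^sub>R (x' s + x' t)) * (\<alpha> * norm (dx s) + b * norm (dy s))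
      + L * norm (p s - p t) * (\<alpha> * norm (dx s) + b * norm (dy s))
      - 1 / (2 * \<gamma>) * ((x' s + x' t) \<bullet> dx s)
      - 1 / (2 * \<gamma> * a) * ((y' s + y' t) \<bullet> (a *\<^sub>R dx s + b *\<^sub>R dy s))) * (s - t)"
      using eventually_at_right_less[of t]
    proof eventually_elim
      case (elim s)
      then show ?case unfolding dx_def dy_def by (rule energy_increment[OF t])
    qed
    show "((\<lambda>s. norm (\<xi> s + G (p t) + (1 / (2 * \<gamma>)) *\<^sub>R (x' s + x' t)) * (\<alpha> * norm (dx s) + b * norm (dy s))
      + L * norm (p s - p t) * (\<alpha> * norm (dx s) + b * norm (dy s))
      - 1 / (2 * \<gamma>) * ((x' s + x' t) \<bullet> dx s)
      - 1 / (2 * \<gamma> * a) * ((y' s + y' t) \<bullet> (a *\<^sub>R dx s + b *\<^sub>R dy s))) \<longlongrightarrow> R) (at_right t)"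
      unfolding R_def \<zeta>_def
      by (intro tendsto_intros lims rc continuous_p continuous_\<xi> continuous_x' continuous_y')
  qed
  moreover have "R \<le> - c * (norm (X' t))\<^sup>2"
  proof -
    define A where "A = norm (x' t)"
    define B where "B = norm (y' t)"
    \<comment> \<open>The velocity \<open>x'\<close> cancels here, which leaves a vector bounded by the speeds with the constants of \<open>dissipation_inequality\<close>.\<close>
    have "\<zeta> = (1 / \<gamma>) *\<^sub>R y' t + (G (p t) - G (x t))"
      by (simp add: \<zeta>_def \<xi>_def scaleR_diff_right scaleR_2[symmetric])
    then have "norm \<zeta> \<le> norm ((1 / \<gamma>) *\<^sub>R y' t) + norm (G (p t) - G (x t))"
      by (simp only: norm_triangle_ineq)
    also have "\<dots> \<le> 1 / \<gamma> * B + L * A"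
      using lip[of "p t" "x t"] pos by (simp add: A_def B_def p_def)
    finally have "norm \<zeta> * (\<alpha> * A + b * B) \<le> (1 / \<gamma> * B + L * A) * (\<alpha> * A + b * B)"
      using \<alpha>_nonneg pos by (intro mult_right_mono) (auto simp: A_def B_def)
    moreover have "- 1 / (2 * \<gamma>) * ((x' t + x' t) \<bullet> x' t) = - 1 / \<gamma> * A\<^sup>2"
      by (simp add: A_def power2_norm_eq_inner inner_add_left)
    moreover have "- 1 / (2 * \<gamma> * a) * ((y' t + y' t) \<bullet> (a *\<^sub>R x' t + b *\<^sub>R y' t))
        = - 1 / \<gamma> * (y' t \<bullet> x' t) - b / (\<gamma> * a) * B\<^sup>2"
      using pos by (simp add: B_def power2_norm_eq_inner inner_add_left inner_add_right field_simps)
    moreover have "- 1 / \<gamma> * (y' t \<bullet> x' t) \<le> 1 / \<gamma> * (A * B)"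
    proof -
      have "- (y' t \<bullet> x' t) \<le> A * B"
        using Cauchy_Schwarz_ineq2[of "y' t" "x' t"] by (simp add: A_def B_def mult.commute)
      then have "1 / \<gamma> * - (y' t \<bullet> x' t) \<le> 1 / \<gamma> * (A * B)"
        using pos by (intro mult_left_mono) auto
      then show ?thesis by simp
    qed
    ultimately have "R \<le> (1 / \<gamma> * B + L * A) * (\<alpha> * A + b * B) - 1 / \<gamma> * A\<^sup>2 + 1 / \<gamma> * (A * B)
        - b / (\<gamma> * a) * B\<^sup>2"
      unfolding R_def A_def[symmetric] B_def[symmetric] by simp
    also have "\<dots> \<le> - c * (A\<^sup>2 + B\<^sup>2)"
      by (rule dissipation_inequality) (auto simp: A_def B_def)
    also have "A\<^sup>2 + B\<^sup>2 = (norm (X' t))\<^sup>2" by (simp add: X'_def A_def B_def norm_Pair)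
    finally show ?thesis .
  qed
  ultimately show ?thesis by (rule upper_dini_le_mono)
qed

sublocale dissipative_curve X X' E c
proof
  fix t :: real assume t: "t \<ge> 0"
  show "(X has_vector_derivative X' t) (at t within {0..})"
    unfolding X_def X'_def by (intro has_vector_derivative_Pair x_deriv y_deriv t)
  show "upper_dini_le E t (- c * (norm (X' t))\<^sup>2)" by (rule energy_dini[OF t])
qed (rule c_pos continuous_E)+

lemma H_along:
  "t \<ge> 0 \<Longrightarrow> H_fun a b \<gamma> f \<Phi> (p t, x t, y t) = ereal (E t)"
proof -
  assume t: "t \<ge> 0"
  have "norm (y' t) = norm (a *\<^sub>R x t + b *\<^sub>R y t)"
    by (simp only: y'_eq[OF t] norm_minus_cancel)
  moreover have "p t - x t = x' t" by (simp add: p_def)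
  moreover obtain r where "f (p t) = ereal r"
    using subgradient_along[OF t] by (auto simp: convex_subgradient_def)
  ultimately show ?thesis by (simp add: H_fun_def E_def)
qed

text \<open>The link between subgradients of \<open>H\<close> and the velocity: all three components at \<open>(p, x, y)\<close> are combinations
  of \<open>x'\<close>, \<open>y'\<close> and \<open>G p - G x\<close>, and the latter is bounded by \<open>L * norm x'\<close>. Through
  this the Lojasiewicz inequality for \<open>H\<close> becomes one for the curve.\<close>

lemma H_subgradient_along:
  "\<exists>K>0. \<forall>t\<ge>0. \<exists>\<zeta>\<in>limiting_subdiff (H_fun a b \<gamma> f \<Phi>) (p t, x t, y t). norm \<zeta> \<le> K * norm (X' t)"
proof (intro exI[of _ "1 / \<gamma> + L + (1 / \<gamma> + 1 / \<gamma>) + b / (\<gamma> * a)"] conjI allI impI)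
  show "1 / \<gamma> + L + (1 / \<gamma> + 1 / \<gamma>) + b / (\<gamma> * a) > 0" using pos by (simp add: add_pos_pos)
  fix t :: real assume t: "t \<ge> 0"
  define q where "q = a *\<^sub>R x t + b *\<^sub>R y t"
  define \<zeta>1 where "\<zeta>1 = \<xi> t + G (p t) + (1 / \<gamma>) *\<^sub>R (p t - x t)"
  define \<zeta>2 where "\<zeta>2 = (1 / \<gamma>) *\<^sub>R q - (1 / \<gamma>) *\<^sub>R (p t - x t)"
  define \<zeta>3 where "\<zeta>3 = (b / (\<gamma> * a)) *\<^sub>R q"
  have "(\<zeta>1, \<zeta>2, \<zeta>3) \<in> limiting_subdiff (H_fun a b \<gamma> f \<Phi>) (p t, x t, y t)"
    unfolding \<zeta>1_def \<zeta>2_def \<zeta>3_def q_def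
    by (intro frechet_subdiff_imp_limiting_subdiff
        H_fun_frechet_subdiff[OF pos(1,3) _ grad lip subgradient_along[OF t]]) (use pos in auto)
  moreover have "norm (\<zeta>1, \<zeta>2, \<zeta>3) \<le> (1 / \<gamma> + L + (1 / \<gamma> + 1 / \<gamma>) + b / (\<gamma> * a)) * norm (X' t)"
  proof -
    have le: "norm (x' t) \<le> norm (X' t)" "norm q \<le> norm (X' t)"
      using norm_fst_le[of "x' t" "y' t"] norm_snd_le[of "y' t" "x' t"] y'_eq[OF t]
      by (auto simp: X'_def q_def norm_minus_cancel simp del: minus_add_distrib)
    have "\<zeta>1 = - (1 / \<gamma>) *\<^sub>R q + (G (p t) - G (x t))"
      by (simp add: \<zeta>1_def \<xi>_def p_def y'_eq[OF t] q_def[symmetric] scaleR_diff_right)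
    then have "norm \<zeta>1 \<le> norm (- (1 / \<gamma>) *\<^sub>R q) + norm (G (p t) - G (x t))"
      by (simp only: norm_triangle_ineq)
    also have "\<dots> \<le> 1 / \<gamma> * norm q + L * norm (x' t)"
      using lip[of "p t" "x t"] pos by (simp add: p_def)
    also have "\<dots> \<le> 1 / \<gamma> * norm (X' t) + L * norm (X' t)"
      using le pos by (intro add_mono mult_left_mono) auto
    finally have 1: "norm \<zeta>1 \<le> (1 / \<gamma> + L) * norm (X' t)" by (simp only: distrib_right)
    have "norm \<zeta>2 \<le> norm ((1 / \<gamma>) *\<^sub>R q) + norm ((1 / \<gamma>) *\<^sub>R (p t - x t))"
      unfolding \<zeta>2_def by (rule norm_triangle_ineq4)
    also have "\<dots> = 1 / \<gamma> * norm q + 1 / \<gamma> * norm (x' t)" using pos by (simp add: p_def)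
    also have "\<dots> \<le> 1 / \<gamma> * norm (X' t) + 1 / \<gamma> * norm (X' t)"
      using le pos by (intro add_mono mult_left_mono) auto
    finally have 2: "norm \<zeta>2 \<le> (1 / \<gamma> + 1 / \<gamma>) * norm (X' t)" by (simp only: distrib_right)
    have "norm \<zeta>3 = b / (\<gamma> * a) * norm q" using pos by (simp add: \<zeta>3_def)
    also have "\<dots> \<le> b / (\<gamma> * a) * norm (X' t)" using le pos by (intro mult_left_mono) auto
    finally have 3: "norm \<zeta>3 \<le> b / (\<gamma> * a) * norm (X' t)" .
    have "norm (\<zeta>1, \<zeta>2, \<zeta>3) \<le> norm \<zeta>1 + norm (\<zeta>2, \<zeta>3)" "norm (\<zeta>2, \<zeta>3) \<le> norm \<zeta>2 + norm \<zeta>3"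
      by (rule norm_Pair_le)+
    then have "norm (\<zeta>1, \<zeta>2, \<zeta>3) \<le> (1 / \<gamma> + L) * norm (X' t) + (1 / \<gamma> + 1 / \<gamma>) * norm (X' t)
        + b / (\<gamma> * a) * norm (X' t)"
      using 1 2 3 by linarith
    then show ?thesis by (simp only: distrib_right)
  qed
  ultimately show "\<exists>\<zeta>\<in>limiting_subdiff (H_fun a b \<gamma> f \<Phi>) (p t, x t, y t).
      norm \<zeta> \<le> (1 / \<gamma> + L + (1 / \<gamma> + 1 / \<gamma>) + b / (\<gamma> * a)) * norm (X' t)"
    by blast
qed

lemma E_bounded_below:
  assumes "t \<ge> 0"
  shows "m \<le> E t"
proof -
  have "m \<le> real_of_ereal (f (p t)) + \<Phi> (p t)"
    using bounded_below[of "p t"] subgradient_along[OF assms]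
    by (cases "f (p t)") (auto simp: convex_subgradient_def)
  moreover have "1 / (2 * \<gamma>) * (norm (x' t))\<^sup>2 \<ge> 0" "1 / (2 * \<gamma> * a) * (norm (y' t))\<^sup>2 \<ge> 0"
    using pos by auto
  ultimately show ?thesis by (simp add: E_def)
qed

end

section \<open>Bounded trajectories and critical cluster points\<close>

locale bounded_prox_gradient_flow = prox_gradient_flow +
  assumes x_bounded: "bounded (x ` {0..})"
begin

text \<open>Boundedness of \<open>y\<close> follows from \<open>(exp (b * t) *\<^sub>R y)' = - (exp (b * t) * a) *\<^sub>R x\<close>, whose
  right-hand side is bounded by a multiple of the derivative of \<open>exp (b * t)\<close>.\<close>

lemma bounded_trajectory: "\<exists>S. \<forall>t\<ge>0. norm (x t) \<le> S \<and> norm (y t) \<le> S"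
proof -
  obtain R where R: "\<And>t. t \<ge> 0 \<Longrightarrow> norm (x t) \<le> R"
    using x_bounded by (auto simp: bounded_iff)
  have "R \<ge> 0" using R[of 0] norm_ge_zero[of "x 0"] by linarith
  have "norm (y t) \<le> norm (y 0) + a * R / b" if t: "t \<ge> 0" for t
  proof (cases "t = 0")
    case True
    then show ?thesis using \<open>R \<ge> 0\<close> pos by simp
  next
    case False
    have "norm (exp (b * t) *\<^sub>R y t - exp (b * 0) *\<^sub>R y 0)
        \<le> a * R / b * exp (b * t) - a * R / b * exp (b * 0)"
    proof (rule differentiable_bound_general[where f = "\<lambda>s. exp (b * s) *\<^sub>R y s"
        and \<phi> = "\<lambda>s. a * R / b * exp (b * s)"])
      show "0 < t" using t False by simp
      show "continuous_on {0..t} (\<lambda>s. exp (b * s) *\<^sub>R y s)"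
        by (intro continuous_intros continuous_on_subset[OF continuous_y]) auto
      show "continuous_on {0..t} (\<lambda>s. a * R / b * exp (b * s))" by (intro continuous_intros)
      fix s assume s: "0 < s" "s < t"
      have "(y has_vector_derivative y' s) (at s within {0<..})"
        using y_deriv[of s] s by (auto intro: has_vector_derivative_within_subset)
      then have ys: "(y has_vector_derivative y' s) (at s)"
        using at_within_open[of s "{0<..}"] s by simp
      have "((\<lambda>s. exp (b * s)) has_real_derivative exp (b * s) * b) (at s)"
        by (auto intro!: derivative_eq_intros)
      then have "((\<lambda>s. exp (b * s) *\<^sub>R y s) has_vector_derivative
          exp (b * s) *\<^sub>R y' s + (exp (b * s) * b) *\<^sub>R y s) (at s)"
        using ys by (intro has_vector_derivative_scaleR)
      also have "exp (b * s) *\<^sub>R y' s + (exp (b * s) * b) *\<^sub>R y s = exp (b * s) *\<^sub>R (- a *\<^sub>R x s)"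
        using s by (simp add: y'_eq algebra_simps)
      finally show "((\<lambda>s. exp (b * s) *\<^sub>R y s) has_vector_derivative
          exp (b * s) *\<^sub>R (- a *\<^sub>R x s)) (at s)" .
      show "((\<lambda>s. a * R / b * exp (b * s)) has_vector_derivative a * R * exp (b * s)) (at s)"
        unfolding has_real_derivative_iff_has_vector_derivative[symmetric]
        using pos by (auto intro!: derivative_eq_intros)
      show "norm (exp (b * s) *\<^sub>R (- a *\<^sub>R x s)) \<le> a * R * exp (b * s)"
        using R[of s] s pos by simp
    qed
    then have "norm (exp (b * t) *\<^sub>R y t - y 0) \<le> a * R / b * exp (b * t) - a * R / b" by simp
    moreover have "a * R / b \<ge> 0" using \<open>R \<ge> 0\<close> pos by simp
    ultimately have "norm (exp (b * t) *\<^sub>R y t - y 0) \<le> a * R / b * exp (b * t)" by linarith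
    then have "exp (b * t) * norm (y t) \<le> norm (y 0) + a * R / b * exp (b * t)"
      using norm_triangle_sub[of "exp (b * t) *\<^sub>R y t" "y 0"] by simp
    also have "norm (y 0) \<le> exp (b * t) * norm (y 0)"
      using t pos by (simp add: mult_le_cancel_right1)
    finally have "exp (b * t) * norm (y t) \<le> exp (b * t) * (norm (y 0) + a * R / b)"
      by (simp add: algebra_simps)
    then show ?thesis by simp
  qed
  then have "\<forall>t\<ge>0. norm (x t) \<le> max R (norm (y 0) + a * R / b)
      \<and> norm (y t) \<le> max R (norm (y 0) + a * R / b)"
    using R by (auto simp: le_max_iff_disj)
  then show ?thesis by blast
qed

lemma bounded_velocity: "\<exists>V>0. \<forall>t\<ge>0. norm (X' t) \<le> V"
proof -
  obtain S where S: "\<And>t. t \<ge> 0 \<Longrightarrow> norm (x t) \<le> S" "\<And>t. t \<ge> 0 \<Longrightarrow> norm (y t) \<le> S"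
    using bounded_trajectory by blast
  have "S \<ge> 0" using S(1)[of 0] norm_ge_zero[of "x 0"] by linarith
  define V where "V = norm (p 0) + \<alpha> * (S + S) + b * (S + S) + S + (a * S + b * S) + 1"
  have "V > 0" using \<open>S \<ge> 0\<close> \<alpha>_nonneg pos by (simp add: V_def add_nonneg_pos)
  moreover have "norm (X' t) \<le> V" if t: "t \<ge> 0" for t
  proof -
    have dx: "norm (x t - x 0) \<le> S + S"
      using norm_triangle_ineq4[of "x t" "x 0"] S(1)[OF t] S(1)[of 0] by linarith
    have dy: "norm (y t - y 0) \<le> S + S"
      using norm_triangle_ineq4[of "y t" "y 0"] S(2)[OF t] S(2)[of 0] by linarith
    have "norm (p t - p 0) \<le> \<alpha> * norm (x t - x 0) + b * norm (y t - y 0)"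
      using p_increment[OF t, of 0] by simp
    also have "\<dots> \<le> \<alpha> * (S + S) + b * (S + S)"
      using dx dy \<alpha>_nonneg pos by (intro add_mono mult_left_mono) auto
    finally have "norm (p t) \<le> norm (p 0) + (\<alpha> * (S + S) + b * (S + S))"
      using norm_triangle_sub[of "p t" "p 0"] by linarith
    moreover have "norm (x' t) \<le> norm (p t) + norm (x t)"
      using norm_triangle_ineq4[of "p t" "x t"] by (simp add: p_def)
    moreover have "norm (y' t) \<le> a * S + b * S"
    proof -
      have "norm (y' t) = norm (a *\<^sub>R x t + b *\<^sub>R y t)"
        by (simp only: y'_eq[OF t] norm_minus_cancel)
      also have "\<dots> \<le> norm (a *\<^sub>R x t) + norm (b *\<^sub>R y t)" by (rule norm_triangle_ineq)
      also have "\<dots> \<le> a * S + b * S"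
        using S t pos by (auto intro!: add_mono mult_left_mono)
      finally show ?thesis .
    qed
    moreover have "norm (X' t) \<le> norm (x' t) + norm (y' t)"
      unfolding X'_def by (rule norm_Pair_le)
    ultimately show ?thesis using S(1)[OF t] unfolding V_def by linarith
  qed
  ultimately show ?thesis by blast
qed

lemma velocity_vanishes: "(X' \<longlongrightarrow> 0) at_top"
proof -
  obtain V where V: "V > 0" "\<And>t. t \<ge> 0 \<Longrightarrow> norm (X' t) \<le> V" using bounded_velocity by blast
  have X_lip: "norm (X s - X t) \<le> V * norm (s - t)" if "s \<ge> 0" "t \<ge> 0" for s t
  proof (rule differentiable_bound[where f = X and S = "{0..}" and f' = "\<lambda>t h. h *\<^sub>R X' t"])
    fix r :: real assume r: "r \<in> {0..}"
    then show "(X has_derivative (\<lambda>h. h *\<^sub>R X' r)) (at r within {0..})"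
      using X_deriv[of r] by (simp add: has_vector_derivative_def)
    show "onorm (\<lambda>h. h *\<^sub>R X' r) \<le> V"
    proof (rule onorm_bound)
      fix h :: real
      show "norm (h *\<^sub>R X' r) \<le> V * norm h"
        using mult_right_mono[of "norm (X' r)" V "\<bar>h\<bar>"] V r by (simp add: mult.commute)
    qed (use V in simp)
  qed (use that in auto)
  define k where "k = \<alpha> + 1 + a + (b + b)"
  have "k > 0" using \<alpha>_nonneg pos by (simp add: k_def)
  have "norm (X' s - X' t) \<le> (k * V) * \<bar>s - t\<bar>" if st: "s \<ge> 0" "t \<ge> 0" for s t
  proof -
    define N where "N = norm (X s - X t)"
    have le: "norm (x s - x t) \<le> N" "norm (y s - y t) \<le> N"
      using norm_fst_le[of "x s - x t" "y s - y t"] norm_snd_le[of "y s - y t" "x s - x t"]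
      by (auto simp: N_def X_def)
    have "norm (p s - p t) \<le> \<alpha> * norm (x s - x t) + b * norm (y s - y t)"
      by (rule p_increment[OF st])
    also have "\<dots> \<le> \<alpha> * N + b * N" using le \<alpha>_nonneg pos by (intro add_mono mult_left_mono) auto
    finally have 1: "norm (p s - p t) \<le> \<alpha> * N + b * N" .
    have "x' s - x' t = (p s - p t) - (x s - x t)" by (simp add: p_def)
    then have 2: "norm (x' s - x' t) \<le> norm (p s - p t) + norm (x s - x t)"
      by (simp only: norm_triangle_ineq4)
    have "y' s - y' t = - (a *\<^sub>R (x s - x t) + b *\<^sub>R (y s - y t))"
      by (simp add: y'_eq st algebra_simps)
    then have "norm (y' s - y' t) = norm (a *\<^sub>R (x s - x t) + b *\<^sub>R (y s - y t))"
      by (simp only: norm_minus_cancel)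
    also have "\<dots> \<le> norm (a *\<^sub>R (x s - x t)) + norm (b *\<^sub>R (y s - y t))" by (rule norm_triangle_ineq)
    also have "\<dots> \<le> a * N + b * N" using le pos by (auto intro!: add_mono mult_left_mono)
    finally have 3: "norm (y' s - y' t) \<le> a * N + b * N" .
    have "norm (X' s - X' t) \<le> norm (x' s - x' t) + norm (y' s - y' t)"
      using norm_Pair_le[of "x' s - x' t" "y' s - y' t"] by (simp add: X'_def)
    also have "\<dots> \<le> k * N" using 1 2 3 le by (simp add: k_def distrib_right)
    also have "\<dots> \<le> k * (V * \<bar>s - t\<bar>)"
      using X_lip[OF st] \<open>k > 0\<close> by (intro mult_left_mono) (auto simp: N_def)
    finally show ?thesis by (simp add: mult.assoc)
  qed
  then show ?thesis
    using velocity_tendsto_zero[of "k * V" m] E_bounded_below \<open>k > 0\<close> V(1) by simp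
qed

lemma x'_vanishes: "(x' \<longlongrightarrow> 0) at_top" and y'_vanishes: "(y' \<longlongrightarrow> 0) at_top"
  using tendsto_fst[OF velocity_vanishes] tendsto_snd[OF velocity_vanishes]
  by (simp_all add: X'_def)

text \<open>At a cluster point \<open>xbar\<close> of \<open>x\<close> the velocities have disappeared, so \<open>p\<close> tends to the same point, \<open>\<xi>\<close>
  to \<open>- G xbar\<close>, and \<open>y\<close> is determined by \<open>a *\<^sub>R x + b *\<^sub>R y = 0\<close>.\<close>

lemma critical_cluster_point:
  obtains \<tau> xbar where "filterlim \<tau> at_top sequentially"
    and "(\<lambda>k. X (\<tau> k)) \<longlonglongrightarrow> (xbar, - (a / b) *\<^sub>R xbar)"
    and "convex_subgradient f xbar (- G xbar)"
    and "(\<lambda>k. E (\<tau> k)) \<longlonglongrightarrow> real_of_ereal (f xbar) + \<Phi> xbar"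
proof -
  have "bounded (range (\<lambda>k::nat. x (real k)))"
    by (rule bounded_subset[OF x_bounded]) auto
  then obtain xbar r where r: "strict_mono (r :: nat \<Rightarrow> nat)" "((\<lambda>k. x (real k)) \<circ> r) \<longlonglongrightarrow> xbar"
    using bounded_imp_convergent_subsequence by blast
  define \<tau> where "\<tau> = (\<lambda>k. real (r k))"
  have \<tau>: "filterlim \<tau> at_top sequentially"
    unfolding \<tau>_def
    by (rule filterlim_compose[OF filterlim_real_sequentially filterlim_subseq[OF r(1)]])
  have \<tau>0: "\<tau> k \<ge> 0" for k by (simp add: \<tau>_def)
  have x: "(\<lambda>k. x (\<tau> k)) \<longlonglongrightarrow> xbar" using r(2) by (simp add: \<tau>_def o_def)
  have x': "(\<lambda>k. x' (\<tau> k)) \<longlonglongrightarrow> 0" and y': "(\<lambda>k. y' (\<tau> k)) \<longlonglongrightarrow> 0"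
    by (rule filterlim_compose[OF x'_vanishes \<tau>] filterlim_compose[OF y'_vanishes \<tau>])+
  have "(\<lambda>k. p (\<tau> k)) \<longlonglongrightarrow> xbar + 0" unfolding p_def by (intro tendsto_intros x x')
  then have p: "(\<lambda>k. p (\<tau> k)) \<longlonglongrightarrow> xbar" by simp
  have cont: "isCont G xbar" "isCont \<Phi> xbar"
    using continuous_G continuous_Phi by (auto simp: continuous_on_eq_continuous_at)
  have "(\<lambda>k. \<xi> (\<tau> k)) \<longlonglongrightarrow> (1 / \<gamma>) *\<^sub>R (0 - 0) - G xbar" unfolding \<xi>_def
    by (intro tendsto_intros x' y' isCont_tendsto_compose[OF cont(1)] x)
  then have \<xi>: "(\<lambda>k. \<xi> (\<tau> k)) \<longlonglongrightarrow> - G xbar" by simp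
  note lim = convex_subgradient_limit[OF f(3,1) subgradient_along[OF \<tau>0] p \<xi>]
  have y_form: "y t = - (1 / b) *\<^sub>R (y' t + a *\<^sub>R x t)" if "t \<ge> 0" for t
    using pos by (simp add: y'_eq[OF that])
  have "(\<lambda>k. - (1 / b) *\<^sub>R (y' (\<tau> k) + a *\<^sub>R x (\<tau> k))) \<longlonglongrightarrow> - (1 / b) *\<^sub>R (0 + a *\<^sub>R xbar)"
    by (intro tendsto_intros x y')
  then have "(\<lambda>k. y (\<tau> k)) \<longlonglongrightarrow> - (a / b) *\<^sub>R xbar"
    using y_form[OF \<tau>0] by simp
  then have "(\<lambda>k. X (\<tau> k)) \<longlonglongrightarrow> (xbar, - (a / b) *\<^sub>R xbar)"
    unfolding X_def by (intro tendsto_Pair x)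
  moreover have "(\<lambda>k. E (\<tau> k)) \<longlonglongrightarrow> real_of_ereal (f xbar) + \<Phi> xbar
      + 1 / (2 * \<gamma>) * (norm (0::'a))\<^sup>2 + 1 / (2 * \<gamma> * a) * (norm (0::'a))\<^sup>2"
    unfolding E_def by (intro tendsto_intros lim(2) x' y' isCont_tendsto_compose[OF cont(2)] p)
  ultimately show ?thesis using that[OF \<tau>] lim(1) by simp
qed

end

section \<open>Convergence to a critical point\<close>

lemma zero_subgradient_imp_crit:
  fixes f :: "'a::euclidean_space \<Rightarrow> ereal"
  assumes "L \<ge> 0" and grad: "\<And>u. GDERIV \<Phi> u :> G u"
    and lip: "\<And>u v. norm (G u - G v) \<le> L * norm (u - v)"
    and sub: "convex_subgradient f xbar (- G xbar)"
  shows "xbar \<in> crit (\<lambda>u. f u + ereal (\<Phi> u))"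
  unfolding crit_def mem_Collect_eq
proof (intro frechet_subdiff_imp_limiting_subdiff quadratic_minorant_imp_frechet_subdiff[where K = L])
  obtain \<alpha> where \<alpha>: "f xbar = ereal \<alpha>" using sub by (auto simp: convex_subgradient_def)
  then show "\<bar>f xbar + ereal (\<Phi> xbar)\<bar> \<noteq> \<infinity>" by simp
  fix u
  have "ereal (\<alpha> - G xbar \<bullet> (u - xbar)) \<le> f u"
    using sub \<alpha> by (auto simp: convex_subgradient_def dest: spec[of _ u])
  moreover have "\<Phi> xbar + G xbar \<bullet> (u - xbar) - L * (norm (u - xbar))\<^sup>2 \<le> \<Phi> u"
    using lipschitz_gradient_quadratic_bound[OF grad lip assms(1), of u xbar] by linarith
  ultimately show "f xbar + ereal (\<Phi> xbar) + ereal (0 \<bullet> (u - xbar) - L * (norm (u - xbar))\<^sup>2)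
      \<le> f u + ereal (\<Phi> u)"
    using \<alpha> by (cases "f u") auto
qed

text \<open>For \<open>\<phi> s = C * s powr (1 - \<theta>)\<close> the inequality \<open>\<phi>' (g w - g z) * dist_to_set 0 (limiting_subdiff g w) \<ge> 1\<close> is, after
  multiplication by \<open>(g w - g z) powr \<theta>\<close>, the Lojasiewicz inequality, restricted to points where \<open>g\<close>
  is slightly larger than at \<open>z\<close>.\<close>

lemma KL_power_imp_Lojasiewicz:
  assumes KL: "KL_property_at g z (\<lambda>s. C * s powr (1 - \<theta>))" and "C > 0" "0 < \<theta>" "\<theta> < 1"
    and fin: "\<bar>g z\<bar> \<noteq> \<infinity>"
  obtains \<epsilon> \<eta> :: real where "\<epsilon> > 0" "\<eta> > 0"
    and "\<And>w v. norm (w - z) < \<epsilon> \<Longrightarrow> v \<in> limiting_subdiff g w \<Longrightarrow> g z < g w \<Longrightarrow>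
      g w < g z + ereal \<eta> \<Longrightarrow> real_of_ereal (g w - g z) powr \<theta> \<le> C * (1 - \<theta>) * norm v"
proof -
  obtain \<eta>\<^sub>0 U where \<eta>\<^sub>0: "\<eta>\<^sub>0 > 0" and U: "open U" "z \<in> U"
    and ineq: "\<And>w. w \<in> U \<Longrightarrow> g z < g w \<Longrightarrow> g w < g z + \<eta>\<^sub>0 \<Longrightarrow>
      1 \<le> ereal (deriv (\<lambda>s. C * s powr (1 - \<theta>)) (real_of_ereal (g w - g z))) * dist_to_set 0 (limiting_subdiff g w)"
    using KL unfolding KL_property_at_def by blast
  obtain \<epsilon> where \<epsilon>: "\<epsilon> > 0" "ball z \<epsilon> \<subseteq> U" using U openE by blast
  obtain \<eta> where \<eta>: "ereal 0 < ereal \<eta>" "ereal \<eta> < \<eta>\<^sub>0"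
    using ereal_dense2[of 0 \<eta>\<^sub>0] \<eta>\<^sub>0 by (auto simp: zero_ereal_def)
  obtain \<alpha> where \<alpha>: "g z = ereal \<alpha>" using fin by auto
  show ?thesis
  proof (rule that[OF \<epsilon>(1)])
    show "\<eta> > 0" using \<eta> by simp
    fix w v assume w: "norm (w - z) < \<epsilon>" and v: "v \<in> limiting_subdiff g w"
      and gt: "g z < g w" and lt: "g w < g z + ereal \<eta>"
    obtain \<beta> where \<beta>: "g w = ereal \<beta>" using gt lt \<alpha> by (cases "g w") auto
    define h where "h = \<beta> - \<alpha>"
    have h: "h > 0" "real_of_ereal (g w - g z) = h" using gt \<alpha> \<beta> by (auto simp: h_def)
    have "w \<in> U" using w \<epsilon>(2) by (auto simp: dist_norm norm_minus_commute)
    moreover have "g w < g z + \<eta>\<^sub>0" using lt \<eta>(2) \<alpha> \<beta> by (cases \<eta>\<^sub>0) auto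
    moreover have "deriv (\<lambda>s. C * s powr (1 - \<theta>)) h = C * (1 - \<theta>) * h powr (- \<theta>)"
    proof (rule DERIV_imp_deriv)
      have "((\<lambda>s. s powr (1 - \<theta>)) has_real_derivative (1 - \<theta>) * h powr (1 - \<theta> - 1)) (at h)"
        by (rule has_real_derivative_powr[OF h(1)])
      then show "((\<lambda>s. C * s powr (1 - \<theta>)) has_real_derivative C * (1 - \<theta>) * h powr (- \<theta>)) (at h)"
        using DERIV_cmult[of "\<lambda>s. s powr (1 - \<theta>)" _ h UNIV C] by (simp add: mult.assoc)
    qed
    ultimately have one: "1 \<le> ereal (C * (1 - \<theta>) * h powr (- \<theta>)) * dist_to_set 0 (limiting_subdiff g w)"
      using ineq[OF _ gt] h(2) by simp
    also have "\<dots> \<le> ereal (C * (1 - \<theta>) * h powr (- \<theta>)) * ereal (norm v)"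
    proof (rule ereal_mult_left_mono)
      have "dist_to_set 0 (limiting_subdiff g w) \<le> ereal (dist 0 v)"
        unfolding dist_to_set_def by (rule INF_lower[OF v])
      then show "dist_to_set 0 (limiting_subdiff g w) \<le> ereal (norm v)" by simp
      show "0 \<le> ereal (C * (1 - \<theta>) * h powr (- \<theta>))" using assms by simp
    qed
    finally have "1 \<le> C * (1 - \<theta>) * h powr (- \<theta>) * norm v" by (simp add: one_ereal_def)
    then have "h powr \<theta> * 1 \<le> h powr \<theta> * (C * (1 - \<theta>) * h powr (- \<theta>) * norm v)"
      by (intro mult_left_mono) auto
    also have "\<dots> = (h powr \<theta> * h powr (- \<theta>)) * (C * (1 - \<theta>) * norm v)" by (simp only: mult_ac)
    also have "h powr \<theta> * h powr (- \<theta>) = 1" using h(1) by (simp add: powr_add[symmetric])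
    finally show "real_of_ereal (g w - g z) powr \<theta> \<le> C * (1 - \<theta>) * norm v" using h(2) by simp
  qed
qed

context bounded_prox_gradient_flow
begin

definition H where "H = H_fun a b \<gamma> f \<Phi>"

text \<open>The limit of \<open>(p, x, y)\<close> if \<open>x\<close> tends to \<open>u\<close> while both velocities vanish.\<close>

definition lift :: "'a \<Rightarrow> 'a \<times> 'a \<times> 'a" where "lift u = (u, u, - (a / b) *\<^sub>R u)"

lemma H_lift: "H (lift u) = f u + ereal (\<Phi> u)"
  using pos by (simp add: H_def lift_def H_fun_def)

lemma lift_crit:
  assumes "convex_subgradient f xbar (- G xbar)"
  shows "lift xbar \<in> crit H"
proof -
  have "(- G xbar + G xbar + (1 / \<gamma>) *\<^sub>R (xbar - xbar),
      (1 / \<gamma>) *\<^sub>R (a *\<^sub>R xbar + b *\<^sub>R (- (a / b) *\<^sub>R xbar)) - (1 / \<gamma>) *\<^sub>R (xbar - xbar),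
      (b / (\<gamma> * a)) *\<^sub>R (a *\<^sub>R xbar + b *\<^sub>R (- (a / b) *\<^sub>R xbar))) \<in> frechet_subdiff H (lift xbar)"
    unfolding H_def lift_def
    by (rule H_fun_frechet_subdiff[OF pos(1,3) _ grad lip assms]) (use pos in auto)
  then have "0 \<in> frechet_subdiff H (lift xbar)"
    using pos by (simp add: zero_prod_def)
  then show ?thesis by (simp add: crit_def frechet_subdiff_imp_limiting_subdiff)
qed

text \<open>As \<open>p - x = x'\<close> tends to \<open>0\<close>, closeness of \<open>(x, y)\<close> to its limit is closeness of \<open>(p, x, y)\<close> to
  the lifted point. The constant \<open>6\<close> leaves half of \<open>\<epsilon>\<close> for the three distances and half for \<open>x'\<close>.\<close>

lemma near_lift:
  assumes "\<epsilon> > 0"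
  obtains T where "T \<ge> 0"
    and "\<And>r. r \<ge> T \<Longrightarrow> norm (X r - (xbar, - (a / b) *\<^sub>R xbar)) < \<epsilon> / 6 \<Longrightarrow>
      norm ((p r, x r, y r) - lift xbar) < \<epsilon>"
proof -
  have "\<forall>\<^sub>F t in at_top. norm (x' t) < \<epsilon> / 2"
    using tendstoD[OF x'_vanishes, of "\<epsilon> / 2"] assms by simp
  then obtain T where T: "\<And>t. t \<ge> T \<Longrightarrow> norm (x' t) < \<epsilon> / 2"
    by (auto simp: eventually_at_top_linorder)
  show ?thesis
  proof (rule that[of "max T 0"])
    fix r assume r: "r \<ge> max T 0" and near: "norm (X r - (xbar, - (a / b) *\<^sub>R xbar)) < \<epsilon> / 6"
    define w where "w = y r - (- (a / b) *\<^sub>R xbar)"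
    have X: "X r - (xbar, - (a / b) *\<^sub>R xbar) = (x r - xbar, w)" by (simp add: X_def w_def)
    have le: "norm (x r - xbar) < \<epsilon> / 6" "norm w < \<epsilon> / 6"
      using near norm_fst_le[of "x r - xbar" w] norm_snd_le[of w "x r - xbar"]
      unfolding X by linarith+
    have "(p r, x r, y r) - lift xbar = (p r - xbar, x r - xbar, w)"
      by (simp add: lift_def w_def)
    then have "norm ((p r, x r, y r) - lift xbar) \<le> norm (p r - xbar) + norm (x r - xbar, w)"
      by (simp only: norm_Pair_le)
    moreover have "norm (x r - xbar, w) \<le> norm (x r - xbar) + norm w" by (rule norm_Pair_le)
    moreover have "norm (p r - xbar) \<le> norm (x r - xbar) + norm (x' r)"
      using norm_triangle_ineq[of "x r - xbar" "x' r"] by (simp add: p_def algebra_simps)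
    ultimately show "norm ((p r, x r, y r) - lift xbar) < \<epsilon>"
      using le T[of r] r by simp
  qed simp
qed

text \<open>The Kurdyka-Lojasiewicz property at the lift of one cluster point is enough: by \<open>near_lift\<close> and
  \<open>H_subgradient_along\<close> it becomes the hypothesis of \<open>convergence_from_cluster_point\<close>.\<close>

lemma convergence_to_critical_point:
  assumes KL: "\<And>z. z \<in> dom_subdiff H \<Longrightarrow>
    \<exists>C>0. \<exists>\<theta>\<in>{0<..<1}. KL_property_at H z (\<lambda>s. C * s powr (1 - \<theta>))"
  obtains xbar where "convex_subgradient f xbar (- G xbar)"
    and "(X \<longlongrightarrow> (xbar, - (a / b) *\<^sub>R xbar)) at_top"
    and "dissipative_curve_nonneg X X' (\<lambda>t. E t - (real_of_ereal (f xbar) + \<Phi> xbar)) c"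
proof -
  obtain \<tau> xbar where \<tau>: "filterlim \<tau> at_top sequentially"
    and X\<tau>: "(\<lambda>k. X (\<tau> k)) \<longlonglongrightarrow> (xbar, - (a / b) *\<^sub>R xbar)"
    and sub: "convex_subgradient f xbar (- G xbar)"
    and E\<tau>: "(\<lambda>k. E (\<tau> k)) \<longlonglongrightarrow> real_of_ereal (f xbar) + \<Phi> xbar"
    using critical_cluster_point .
  define e where "e = real_of_ereal (f xbar) + \<Phi> xbar"
  have E_ge: "\<And>t. t \<ge> 0 \<Longrightarrow> e \<le> E t" and E_lim: "(E \<longlongrightarrow> e) at_top"
    using energy_along_sequence[OF \<tau> E\<tau>] by (simp_all add: e_def)
  interpret h: dissipative_curve_nonneg X X' "\<lambda>t. E t - e" c
    by (intro dissipative_curve_nonneg.intro shift_energy dissipative_curve_nonneg_axioms.intro)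
      (simp add: E_ge)
  have Hbar: "H (lift xbar) = ereal e"
    using sub unfolding H_lift e_def convex_subgradient_def by (cases "f xbar") auto
  have "lift xbar \<in> dom_subdiff H"
    using lift_crit[OF sub] unfolding dom_subdiff_def crit_def by blast
  from KL[OF this] obtain C \<theta> where C: "C > 0" "0 < \<theta>" "\<theta> < 1"
    and KLbar: "KL_property_at H (lift xbar) (\<lambda>s. C * s powr (1 - \<theta>))"
    by auto
  obtain \<epsilon> \<eta> :: real where \<epsilon>: "\<epsilon> > 0" and \<eta>: "\<eta> > 0"
    and loj: "\<And>w v. norm (w - lift xbar) < \<epsilon> \<Longrightarrow> v \<in> limiting_subdiff H w \<Longrightarrow> H (lift xbar) < H w \<Longrightarrow>
      H w < H (lift xbar) + ereal \<eta> \<Longrightarrow>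
      real_of_ereal (H w - H (lift xbar)) powr \<theta> \<le> C * (1 - \<theta>) * norm v"
    using KL_power_imp_Lojasiewicz[OF KLbar C] Hbar by auto
  obtain K where K: "K > 0" "\<And>t. t \<ge> 0 \<Longrightarrow>
      \<exists>\<zeta>\<in>limiting_subdiff H (p t, x t, y t). norm \<zeta> \<le> K * norm (X' t)"
    using H_subgradient_along unfolding H_def by blast
  obtain T\<^sub>1 where T1: "T\<^sub>1 \<ge> 0"
    "\<And>r. r \<ge> T\<^sub>1 \<Longrightarrow> norm (X r - (xbar, - (a / b) *\<^sub>R xbar)) < \<epsilon> / 6 \<Longrightarrow>
      norm ((p r, x r, y r) - lift xbar) < \<epsilon>"
    using near_lift[OF \<epsilon>] by metis
  have "\<forall>\<^sub>F t in at_top. E t < e + \<eta>" using order_tendstoD(2)[OF E_lim] \<eta> by simp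
  then obtain T\<^sub>2 where T2: "\<And>t. t \<ge> T\<^sub>2 \<Longrightarrow> E t < e + \<eta>" by (auto simp: eventually_at_top_linorder)
  have "(X \<longlongrightarrow> (xbar, - (a / b) *\<^sub>R xbar)) at_top"
  proof (rule h.convergence_from_cluster_point[OF C(2,3) _ _ _ _ _ \<tau> X\<tau>])
    show "C * (1 - \<theta>) * K > 0" "\<epsilon> / 6 > 0" "max T\<^sub>1 T\<^sub>2 \<ge> 0" using C K(1) \<epsilon> T1(1) by auto
    show "((\<lambda>t. E t - e) \<longlongrightarrow> 0) at_top" using E_lim by (rule LIM_zero)
    fix r assume r: "r \<ge> max T\<^sub>1 T\<^sub>2" and near: "norm (X r - (xbar, - (a / b) *\<^sub>R xbar)) < \<epsilon> / 6"
    then have r0: "r \<ge> 0" "r \<ge> T\<^sub>1" "r \<ge> T\<^sub>2" using T1(1) by auto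
    show "(E r - e) powr \<theta> \<le> C * (1 - \<theta>) * K * norm (X' r)"
    \<comment> \<open>If the energy has reached its limit, the left-hand side is \<open>0\<close>; the Kurdyka-Lojasiewicz property only speaks about larger values.\<close>
    proof (cases "E r = e")
      case True
      then show ?thesis using C K(1) by simp
    next
      case False
      then have gt: "e < E r" using E_ge[OF r0(1)] by simp
      obtain \<zeta> where \<zeta>: "\<zeta> \<in> limiting_subdiff H (p r, x r, y r)" "norm \<zeta> \<le> K * norm (X' r)"
        using K(2)[OF r0(1)] by blast
      have Hr: "H (p r, x r, y r) = ereal (E r)" using H_along[OF r0(1)] by (simp add: H_def)
      have "(E r - e) powr \<theta> \<le> C * (1 - \<theta>) * norm \<zeta>"
        using loj[OF T1(2)[OF r0(2) near] \<zeta>(1)] gt T2[OF r0(3)] by (simp add: Hr Hbar)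
      also have "\<dots> \<le> C * (1 - \<theta>) * (K * norm (X' r))"
        using \<zeta>(2) C by (intro mult_left_mono) auto
      finally show ?thesis by (simp add: mult.assoc)
    qed
  qed
  then show ?thesis
    using that[OF sub] h.dissipative_curve_nonneg_axioms unfolding e_def by blast
qed

lemma Lojasiewicz_along_flow:
  assumes sub: "convex_subgradient f xbar (- G xbar)"
    and lim: "(X \<longlongrightarrow> (xbar, - (a / b) *\<^sub>R xbar)) at_top"
    and h: "dissipative_curve_nonneg X X' (\<lambda>t. E t - (real_of_ereal (f xbar) + \<Phi> xbar)) c"
    and \<theta>: "0 < \<theta>" "\<theta> < 1" and loj: "Lojasiewicz_exponent_at H (lift xbar) \<theta>"
  obtains M T where "Lojasiewicz_curve X X' (\<lambda>t. E t - (real_of_ereal (f xbar) + \<Phi> xbar)) c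
    \<theta> M T (xbar, - (a / b) *\<^sub>R xbar)"
proof -
  define e where "e = real_of_ereal (f xbar) + \<Phi> xbar"
  have Hbar: "H (lift xbar) = ereal e"
    using sub unfolding H_lift e_def convex_subgradient_def by (cases "f xbar") auto
  obtain C \<epsilon> where C: "C > 0" and \<epsilon>: "\<epsilon> > 0"
    and ineq: "\<And>z v. norm (z - lift xbar) < \<epsilon> \<Longrightarrow> v \<in> limiting_subdiff H z \<Longrightarrow>
      \<bar>real_of_ereal (H z - H (lift xbar))\<bar> powr \<theta> \<le> C * norm v"
    using loj unfolding Lojasiewicz_exponent_at_def by blast
  obtain K where K: "K > 0" "\<And>t. t \<ge> 0 \<Longrightarrow>
      \<exists>\<zeta>\<in>limiting_subdiff H (p t, x t, y t). norm \<zeta> \<le> K * norm (X' t)"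
    using H_subgradient_along unfolding H_def by blast
  obtain T\<^sub>1 where T1: "T\<^sub>1 \<ge> 0"
    "\<And>r. r \<ge> T\<^sub>1 \<Longrightarrow> norm (X r - (xbar, - (a / b) *\<^sub>R xbar)) < \<epsilon> / 6 \<Longrightarrow>
      norm ((p r, x r, y r) - lift xbar) < \<epsilon>"
    using near_lift[OF \<epsilon>] by metis
  have "\<forall>\<^sub>F t in at_top. norm (X t - (xbar, - (a / b) *\<^sub>R xbar)) < \<epsilon> / 6"
    using tendstoD[OF lim, of "\<epsilon> / 6"] \<epsilon> by (simp add: dist_norm)
  then obtain T\<^sub>2 where T2: "\<And>t. t \<ge> T\<^sub>2 \<Longrightarrow> norm (X t - (xbar, - (a / b) *\<^sub>R xbar)) < \<epsilon> / 6"
    by (auto simp: eventually_at_top_linorder)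
  have "(E r - e) powr \<theta> \<le> C * K * norm (X' r)" if r: "r \<ge> max T\<^sub>1 T\<^sub>2" for r
  proof -
    have r0: "r \<ge> 0" "r \<ge> T\<^sub>1" "r \<ge> T\<^sub>2" using T1(1) r by auto
    obtain \<zeta> where \<zeta>: "\<zeta> \<in> limiting_subdiff H (p r, x r, y r)" "norm \<zeta> \<le> K * norm (X' r)"
      using K(2)[OF r0(1)] by blast
    have Hr: "H (p r, x r, y r) = ereal (E r)" using H_along[OF r0(1)] by (simp add: H_def)
    have "E r - e \<ge> 0"
      using dissipative_curve_nonneg.h_nonneg[OF h r0(1)] by (simp add: e_def)
    then have "(E r - e) powr \<theta> \<le> C * norm \<zeta>"
      using ineq[OF T1(2)[OF r0(2) T2[OF r0(3)]] \<zeta>(1)] by (simp add: Hr Hbar)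
    also have "\<dots> \<le> C * (K * norm (X' r))"
      using \<zeta>(2) C by (intro mult_left_mono) auto
    finally show ?thesis by (simp add: mult.assoc)
  qed
  then have "Lojasiewicz_curve X X' (\<lambda>t. E t - e) c \<theta> (C * K) (max T\<^sub>1 T\<^sub>2) (xbar, - (a / b) *\<^sub>R xbar)"
    using h \<theta> C K(1) T1(1) lim
    by (intro Lojasiewicz_curve.intro Lojasiewicz_curve_axioms.intro) (auto simp: e_def)
  then show ?thesis using that unfolding e_def by blast
qed

lemma convergence_rates:
  assumes sub: "convex_subgradient f xbar (- G xbar)"
    and lim: "(X \<longlongrightarrow> (xbar, - (a / b) *\<^sub>R xbar)) at_top"
    and h: "dissipative_curve_nonneg X X' (\<lambda>t. E t - (real_of_ereal (f xbar) + \<Phi> xbar)) c"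
    and \<theta>: "0 < \<theta>" "\<theta> < 1" and loj: "Lojasiewicz_exponent_at H (lift xbar) \<theta>"
  defines "D \<equiv> \<lambda>t. norm (x t - xbar) + norm (y t + (a / b) *\<^sub>R xbar)"
  shows "\<theta> < 1 / 2 \<Longrightarrow> \<exists>T\<ge>0. \<forall>s\<ge>T. x s = x T \<and> y s = y T"
    and "\<theta> = 1 / 2 \<Longrightarrow> \<exists>a\<^sub>1>0. \<exists>b\<^sub>1>0. \<exists>t\<^sub>0\<ge>0. \<forall>t\<ge>t\<^sub>0. D t \<le> a\<^sub>1 * exp (- b\<^sub>1 * t)"
    and "\<theta> > 1 / 2 \<Longrightarrow> \<exists>a\<^sub>2>0. \<exists>b\<^sub>2>0. \<exists>t\<^sub>0\<ge>0. \<forall>t\<ge>t\<^sub>0.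
      D t \<le> (a\<^sub>2 * t + b\<^sub>2) powr (- ((1 - \<theta>) / (2 * \<theta> - 1)))"
proof -
  obtain M T where "Lojasiewicz_curve X X' (\<lambda>t. E t - (real_of_ereal (f xbar) + \<Phi> xbar)) c
    \<theta> M T (xbar, - (a / b) *\<^sub>R xbar)"
    using Lojasiewicz_along_flow[OF sub lim h \<theta> loj] .
  then interpret l: Lojasiewicz_curve X X' "\<lambda>t. E t - (real_of_ereal (f xbar) + \<Phi> xbar)" c
    \<theta> M T "(xbar, - (a / b) *\<^sub>R xbar)" .
  have D_le: "D t \<le> 2 * norm (X t - (xbar, - (a / b) *\<^sub>R xbar))" for t
    using norm_fst_le[of "x t - xbar" "y t + (a / b) *\<^sub>R xbar"]
      norm_snd_le[of "y t + (a / b) *\<^sub>R xbar" "x t - xbar"]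
    by (simp add: D_def X_def)
  show "\<exists>T\<ge>0. \<forall>s\<ge>T. x s = x T \<and> y s = y T" if "\<theta> < 1 / 2"
    using l.finite_time_convergence[OF that] by (simp add: X_def)
  show "\<exists>a\<^sub>1>0. \<exists>b\<^sub>1>0. \<exists>t\<^sub>0\<ge>0. \<forall>t\<ge>t\<^sub>0. D t \<le> a\<^sub>1 * exp (- b\<^sub>1 * t)" if half: "\<theta> = 1 / 2"
  proof -
    obtain A B where "A > 0" "B > 0"
      and "\<And>t. t \<ge> T \<Longrightarrow> 2 * norm (X t - (xbar, - (a / b) *\<^sub>R xbar)) \<le> A * exp (- B * t)"
      using l.exponential_rate[OF half, of 2] by auto
    then show ?thesis using order_trans[OF D_le] l.T_nonneg by blast
  qed
  show "\<exists>a\<^sub>2>0. \<exists>b\<^sub>2>0. \<exists>t\<^sub>0\<ge>0. \<forall>t\<ge>t\<^sub>0.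
      D t \<le> (a\<^sub>2 * t + b\<^sub>2) powr (- ((1 - \<theta>) / (2 * \<theta> - 1)))" if large: "\<theta> > 1 / 2"
  proof -
    obtain A B where "A > 0" "B > 0"
      and "\<And>t. t \<ge> 2 * T + 1 \<Longrightarrow> 2 * norm (X t - (xbar, - (a / b) *\<^sub>R xbar))
        \<le> (A * t + B) powr (- ((1 - \<theta>) / (2 * \<theta> - 1)))"
      using l.polynomial_rate[OF large, of 2] by auto
    moreover have "2 * T + 1 \<ge> 0" using l.T_nonneg by simp
    ultimately show ?thesis using order_trans[OF D_le] by blast
  qed
qed

end

theorem theorem13:
  fixes a b \<gamma> L :: real
    and f :: "real ^ 'n \<Rightarrow> ereal"
    and \<Phi> :: "real ^ 'n \<Rightarrow> real"
    and grad\<Phi> :: "real ^ 'n \<Rightarrow> real ^ 'n"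
    and x0 y0 :: "real ^ 'n"
    and x x' y y' y'' :: "real \<Rightarrow> real ^ 'n"
  assumes "a > 0" and "b > 0" and "\<gamma> > 0" and "L > 0"
    and "proper_fun f" and "convex_fun f" and "lsc_fun f"
    and "\<And>u. GDERIV \<Phi> u :> grad\<Phi> u"
    and "\<And>u v. norm (grad\<Phi> u - grad\<Phi> v) \<le> L * norm (u - v)"
    and "\<exists>m::real. \<forall>u. ereal m \<le> f u + ereal (\<Phi> u)"
    and "2 * \<gamma> * L * (\<bar>1 - a\<bar> + \<gamma> * L) + \<bar>1 - a\<bar> + \<gamma> * L + b * \<gamma> * L < 1"
    and "a * b + a / 2 + 1 / 2 * a * \<bar>1 - a\<bar> + 1 / 2 * \<gamma> * a * L + 1 / 2 * \<gamma> * a * b * L < b"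
    and "C1_halfline x x'" and "C1_halfline y y'" and "C1_halfline y' y''"
    and "\<And>t. t \<ge> 0 \<Longrightarrow>
           x' t + x t = prox \<gamma> f (x t - \<gamma> *\<^sub>R grad\<Phi> (x t) - a *\<^sub>R x t - b *\<^sub>R y t)"
    and "\<And>t. t \<ge> 0 \<Longrightarrow> y' t + a *\<^sub>R x t + b *\<^sub>R y t = 0"
    and "x 0 = x0" and "y 0 = y0"
    and "bounded (x ` {0..})"
    and "\<And>z. z \<in> dom_subdiff (H_fun a b \<gamma> f \<Phi>) \<Longrightarrow>
           \<exists>C>0. \<exists>\<theta>\<in>{0<..<1}. KL_property_at (H_fun a b \<gamma> f \<Phi>) z (\<lambda>s. C * s powr (1 - \<theta>))"
  shows "\<exists>xbar \<in> crit (\<lambda>u. f u + ereal (\<Phi> u)).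
           (x \<longlongrightarrow> xbar) at_top \<and> (y \<longlongrightarrow> - (a / b) *\<^sub>R xbar) at_top \<and>
           (xbar, xbar, - (a / b) *\<^sub>R xbar) \<in> crit (H_fun a b \<gamma> f \<Phi>) \<and>
           (\<forall>\<theta>\<in>{0<..<1}.
              Lojasiewicz_exponent_at (H_fun a b \<gamma> f \<Phi>) (xbar, xbar, - (a / b) *\<^sub>R xbar) \<theta> \<longrightarrow>
              (\<exists>a\<^sub>1>0. \<exists>b\<^sub>1>0. \<exists>a\<^sub>2>0. \<exists>b\<^sub>2>0. \<exists>t\<^sub>0\<ge>0. \<forall>t\<ge>t\<^sub>0.
                 (\<theta> < 1 / 2 \<longrightarrow>
                    (\<exists>T\<ge>0. \<forall>s\<ge>T. x s = x T \<and> y s = y T)) \<and>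
                 (\<theta> = 1 / 2 \<longrightarrow>
                    norm (x t - xbar) + norm (y t + (a / b) *\<^sub>R xbar) \<le> a\<^sub>1 * exp (- b\<^sub>1 * t)) \<and>
                 (\<theta> > 1 / 2 \<longrightarrow>
                    norm (x t - xbar) + norm (y t + (a / b) *\<^sub>R xbar)
                      \<le> (a\<^sub>2 * t + b\<^sub>2) powr (- ((1 - \<theta>) / (2 * \<theta> - 1))))))"
proof -
  obtain m where m: "\<And>u. ereal m \<le> f u + ereal (\<Phi> u)" using assms(10) by blast
  interpret bounded_prox_gradient_flow a b \<gamma> L m f \<Phi> grad\<Phi> x x' y y'
    by unfold_locales (use assms m in \<open>auto simp: C1_halfline_def\<close>)
  obtain xbar where sub: "convex_subgradient f xbar (- grad\<Phi> xbar)"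
    and lim: "(X \<longlongrightarrow> (xbar, - (a / b) *\<^sub>R xbar)) at_top"
    and h: "dissipative_curve_nonneg X X' (\<lambda>t. E t - (real_of_ereal (f xbar) + \<Phi> xbar)) c"
    using convergence_to_critical_point assms(21) unfolding H_def by blast
  show ?thesis
  proof (intro bexI[of _ xbar] conjI ballI impI)
    show "xbar \<in> crit (\<lambda>u. f u + ereal (\<Phi> u))"
      using zero_subgradient_imp_crit[OF _ grad lip sub] pos by simp
    show "(x \<longlongrightarrow> xbar) at_top" "(y \<longlongrightarrow> - (a / b) *\<^sub>R xbar) at_top"
      using tendsto_fst[OF lim] tendsto_snd[OF lim] by (simp_all add: X_def)
    show "(xbar, xbar, - (a / b) *\<^sub>R xbar) \<in> crit (H_fun a b \<gamma> f \<Phi>)"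
      using lift_crit[OF sub] by (simp add: H_def lift_def)
    fix \<theta> :: real
    assume \<theta>: "\<theta> \<in> {0<..<1}"
      and loj: "Lojasiewicz_exponent_at (H_fun a b \<gamma> f \<Phi>) (xbar, xbar, - (a / b) *\<^sub>R xbar) \<theta>"
    have "Lojasiewicz_exponent_at H (lift xbar) \<theta>" using loj by (simp add: H_def lift_def)
    note rates = convergence_rates[OF sub lim h _ _ this]
    consider "\<theta> < 1 / 2" | "\<theta> = 1 / 2" | "\<theta> > 1 / 2" by linarith
    then show "\<exists>a\<^sub>1>0. \<exists>b\<^sub>1>0. \<exists>a\<^sub>2>0. \<exists>b\<^sub>2>0. \<exists>t\<^sub>0\<ge>0. \<forall>t\<ge>t\<^sub>0.
        (\<theta> < 1 / 2 \<longrightarrow> (\<exists>T\<ge>0. \<forall>s\<ge>T. x s = x T \<and> y s = y T)) \<and>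
        (\<theta> = 1 / 2 \<longrightarrow> norm (x t - xbar) + norm (y t + (a / b) *\<^sub>R xbar) \<le> a\<^sub>1 * exp (- b\<^sub>1 * t)) \<and>
        (\<theta> > 1 / 2 \<longrightarrow> norm (x t - xbar) + norm (y t + (a / b) *\<^sub>R xbar)
          \<le> (a\<^sub>2 * t + b\<^sub>2) powr (- ((1 - \<theta>) / (2 * \<theta> - 1))))"
    proof cases
      case 1
      then have "\<exists>T\<ge>0. \<forall>s\<ge>T. x s = x T \<and> y s = y T" using rates(1) \<theta> by simp
      with 1 have "\<forall>t\<ge>0. (\<theta> < 1 / 2 \<longrightarrow> (\<exists>T\<ge>0. \<forall>s\<ge>T. x s = x T \<and> y s = y T)) \<and>
          (\<theta> = 1 / 2 \<longrightarrow> norm (x t - xbar) + norm (y t + (a / b) *\<^sub>R xbar) \<le> 1 * exp (- 1 * t)) \<and>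
          (\<theta> > 1 / 2 \<longrightarrow> norm (x t - xbar) + norm (y t + (a / b) *\<^sub>R xbar)
            \<le> (1 * t + 1) powr (- ((1 - \<theta>) / (2 * \<theta> - 1))))"
        by simp
      then show ?thesis using zero_less_one order_refl by blast
    next
      case 2
      then obtain a\<^sub>1 b\<^sub>1 t\<^sub>0 where "a\<^sub>1 > 0" "b\<^sub>1 > 0" "t\<^sub>0 \<ge> 0"
        and "\<And>t. t \<ge> t\<^sub>0 \<Longrightarrow> norm (x t - xbar) + norm (y t + (a / b) *\<^sub>R xbar) \<le> a\<^sub>1 * exp (- b\<^sub>1 * t)"
        using rates(2) \<theta> by auto
      with 2 show ?thesis
        by (intro exI[of _ a\<^sub>1] exI[of _ b\<^sub>1] exI[of _ 1] exI[of _ t\<^sub>0] conjI allI impI) auto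
    next
      case 3
      then obtain a\<^sub>2 b\<^sub>2 t\<^sub>0 where "a\<^sub>2 > 0" "b\<^sub>2 > 0" "t\<^sub>0 \<ge> 0"
        and "\<And>t. t \<ge> t\<^sub>0 \<Longrightarrow> norm (x t - xbar) + norm (y t + (a / b) *\<^sub>R xbar)
          \<le> (a\<^sub>2 * t + b\<^sub>2) powr (- ((1 - \<theta>) / (2 * \<theta> - 1)))"
        using rates(3) \<theta> by auto
      with 3 show ?thesis
        by (intro exI[of _ 1] exI[of _ a\<^sub>2] exI[of _ b\<^sub>2] exI[of _ t\<^sub>0] conjI allI impI) auto
    qed
  qed
qed

end
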